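(* Let $A$ be a ring with unit. If $(\mathcal{C},\Delta,\varepsilon)$ is a left unital weak (resp. lax) $A$-coring, then $({}^*\mathcal{C},\mu,\eta)$ is a right unital weak (resp. lax) $A$-ring. Moreover, the $A$-rings $1_A{}^*\mathcal{C}$ and ${}^*(\mathcal{C}1_A)$ are isomorphic.
   Context: $A$-modules are not assumed unital. An $A$-coring is $(\mathcal{C},\Delta,\varepsilon)$ with $\mathcal{C}$ a unital $A$-bimodule and $\Delta:\mathcal{C}\to\mathcal{C}\otimes_A\mathcal{C}$, $\Delta(c)=c_{(1)}\otimes_Ac_{(2)}$, $\varepsilon:\mathcal{C}\to A$ $A$-bimodule maps satisfying coassociativity $(\Delta\otimes_A\mathcal{C})\circ\Delta=(\mathcal{C}\otimes_A\Delta)\circ\Delta$ and the counit property. A left unital lax (resp. weak) $A$-coring is $(\mathcal{C},\Delta,\varepsilon)$ with $\mathcal{C}$ an $A$-bimodule that is unital as a left module, $\Delta:\mathcal{C}\to\mathcal{C}\otimes_A\mathcal{C}$ and $\varepsilon:\mathcal{C}\to A$ $A$-bimodule maps, $\Delta$ coassociative, and such that $c=\varepsilon(c_{(1)})c_{(2)}=c_{(1)}\varepsilon(c_{(2)})$ for all $c\in\mathcal{C}1_A$ (resp. $c1_A=\varepsilon(c_{(1)})c_{(2)}=c_{(1)}\varepsilon(c_{(2)})$ for all $c\in\mathcal{C}$). Then $\mathcal{C}1_A$, with the restrictions of $\Delta$ and $\varepsilon$, is an $A$-coring. An $A$-ring is $(\mathcal{R},\mu,\eta)$ with $\mathcal{R}$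 a unital $A$-bimodule and $\mu:\mathcal{R}\otimes_A\mathcal{R}\to\mathcal{R}$, $\eta:A\to\mathcal{R}$ $A$-bimodule maps that are associative and unital. A right unital lax (resp. weak) $A$-ring is $(\mathcal{R},\mu,\eta)$ with $\mathcal{R}$ an $A$-bimodule that is unital as a right module, $\mu:\mathcal{R}\otimes_A\mathcal{R}\to\mathcal{R}$ (written $\mu(r\otimes_A s)=rs$) an associative $A$-bimodule map and $\eta:A\to\mathcal{R}$ an $A$-bimodule map such that, with $1_{\mathcal{R}}=\eta(1_A)$, $r=1_{\mathcal{R}}r=r1_{\mathcal{R}}$ for all $r\in1_A\mathcal{R}$ (resp. $1_Ar=1_{\mathcal{R}}r=r1_{\mathcal{R}}$ for all $r\in\mathcal{R}$). Then $1_A\mathcal{R}$ is an $A$-ring with the restricted multiplication and corestricted $\eta$. For an $A$-bimodule $\mathcal{C}$ that is unital as a left module, with a coassociative $A$-bimodule map $\Delta:\mathcal{C}\to\mathcal{C}\otimes_A\mathcal{C}$, $\Delta(c)=c_{(1)}\otimes_Ac_{(2)}$, and an $A$-bimodule map $\varepsilon:\mathcal{C}\to A$, the set ${}^*\mathcal{C}={}_A{\rm Hom}(\mathcal{C},A)$ (left $A$-linear maps) is a right unital $A$-bimodule via $(afb)(c)=f(ca)b$; $\mu(f\otimes_Ag)=f\#g$ with $(f\#g)(c)=g(c_{(1)}f(c_{(2)}))$; and $\eta(a)=a\varepsilon=\varepsilon a$, i.e. $\eta(a)(c)=\varepsilon(c)a$. The $A$-ring structure on ${}^*(\mathcal{C}1_A)$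 is given by the same formulas applied to the $A$-coring $\mathcal{C}1_A$. *)

theory Defs
  imports "HOL-Algebra.Free_Abelian_Groups" "HOL-Algebra.Module"
begin

section \<open>Bimodules over a ring with unit, not assumed unital\<close>

text \<open>As for the records of \<^theory>\<open>HOL-Algebra.Module\<close>, only the additive part of the underlying
  ring record is relevant; the fields \<^const>\<open>monoid.mult\<close> and \<^const>\<open>one\<close> are never used.\<close>

record ('a, 'm) bimodule = "'m ring" +
  lact :: "'a \<Rightarrow> 'm \<Rightarrow> 'm" (infixr \<open>\<rightharpoonup>\<index>\<close> 75)
  ract :: "'m \<Rightarrow> 'a \<Rightarrow> 'm" (infixl \<open>\<leftharpoonup>\<index>\<close> 75)

locale bimodule = A?: ring A + M?: abelian_group M
  for A :: "('a, 'x) ring_scheme" (structure) and M :: "('a, 'm) bimodule" (structure) +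
  assumes lact_closed: "\<lbrakk>a \<in> carrier A; m \<in> carrier M\<rbrakk> \<Longrightarrow> a \<rightharpoonup>\<^bsub>M\<^esub> m \<in> carrier M"
    and ract_closed: "\<lbrakk>a \<in> carrier A; m \<in> carrier M\<rbrakk> \<Longrightarrow> m \<leftharpoonup>\<^bsub>M\<^esub> a \<in> carrier M"
    and lact_add: "\<lbrakk>a \<in> carrier A; m \<in> carrier M; n \<in> carrier M\<rbrakk>
      \<Longrightarrow> a \<rightharpoonup>\<^bsub>M\<^esub> (m \<oplus>\<^bsub>M\<^esub> n) = (a \<rightharpoonup>\<^bsub>M\<^esub> m) \<oplus>\<^bsub>M\<^esub> (a \<rightharpoonup>\<^bsub>M\<^esub> n)"
    and add_lact: "\<lbrakk>a \<in> carrier A; b \<in> carrier A; m \<in> carrier M\<rbrakk>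
      \<Longrightarrow> (a \<oplus>\<^bsub>A\<^esub> b) \<rightharpoonup>\<^bsub>M\<^esub> m = (a \<rightharpoonup>\<^bsub>M\<^esub> m) \<oplus>\<^bsub>M\<^esub> (b \<rightharpoonup>\<^bsub>M\<^esub> m)"
    and ract_add: "\<lbrakk>a \<in> carrier A; b \<in> carrier A; m \<in> carrier M\<rbrakk>
      \<Longrightarrow> m \<leftharpoonup>\<^bsub>M\<^esub> (a \<oplus>\<^bsub>A\<^esub> b) = (m \<leftharpoonup>\<^bsub>M\<^esub> a) \<oplus>\<^bsub>M\<^esub> (m \<leftharpoonup>\<^bsub>M\<^esub> b)"
    and add_ract: "\<lbrakk>a \<in> carrier A; m \<in> carrier M; n \<in> carrier M\<rbrakk>
      \<Longrightarrow> (m \<oplus>\<^bsub>M\<^esub> n) \<leftharpoonup>\<^bsub>M\<^esub> a = (m \<leftharpoonup>\<^bsub>M\<^esub> a) \<oplus>\<^bsub>M\<^esub> (n \<leftharpoonup>\<^bsub>M\<^esub> a)"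
    and mult_lact: "\<lbrakk>a \<in> carrier A; b \<in> carrier A; m \<in> carrier M\<rbrakk>
      \<Longrightarrow> (a \<otimes>\<^bsub>A\<^esub> b) \<rightharpoonup>\<^bsub>M\<^esub> m = a \<rightharpoonup>\<^bsub>M\<^esub> (b \<rightharpoonup>\<^bsub>M\<^esub> m)"
    and ract_mult: "\<lbrakk>a \<in> carrier A; b \<in> carrier A; m \<in> carrier M\<rbrakk>
      \<Longrightarrow> m \<leftharpoonup>\<^bsub>M\<^esub> (a \<otimes>\<^bsub>A\<^esub> b) = (m \<leftharpoonup>\<^bsub>M\<^esub> a) \<leftharpoonup>\<^bsub>M\<^esub> b"
    and lact_ract: "\<lbrakk>a \<in> carrier A; b \<in> carrier A; m \<in> carrier M\<rbrakk>
      \<Longrightarrow> (a \<rightharpoonup>\<^bsub>M\<^esub> m) \<leftharpoonup>\<^bsub>M\<^esub> b = a \<rightharpoonup>\<^bsub>M\<^esub> (m \<leftharpoonup>\<^bsub>M\<^esub> b)"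

definition left_unital :: "('a, 'x) ring_scheme \<Rightarrow> ('a, 'm) bimodule \<Rightarrow> bool" where
  "left_unital A M \<longleftrightarrow> (\<forall>m\<in>carrier M. \<one>\<^bsub>A\<^esub> \<rightharpoonup>\<^bsub>M\<^esub> m = m)"

definition right_unital :: "('a, 'x) ring_scheme \<Rightarrow> ('a, 'm) bimodule \<Rightarrow> bool" where
  "right_unital A M \<longleftrightarrow> (\<forall>m\<in>carrier M. m \<leftharpoonup>\<^bsub>M\<^esub> \<one>\<^bsub>A\<^esub> = m)"

definition regular_bimodule :: "('a, 'x) ring_scheme \<Rightarrow> ('a, 'a) bimodule" where
  "regular_bimodule A =
    \<lparr>carrier = carrier A, monoid.mult = monoid.mult A, one = \<one>\<^bsub>A\<^esub>, ring.zero = \<zero>\<^bsub>A\<^esub>, add = add A,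
     lact = monoid.mult A, ract = monoid.mult A\<rparr>"

definition bimodule_hom ::
    "('a, 'x) ring_scheme \<Rightarrow> ('a, 'm) bimodule \<Rightarrow> ('a, 'n) bimodule \<Rightarrow> ('m \<Rightarrow> 'n) set" where
  "bimodule_hom A M N =
    {f \<in> carrier M \<rightarrow> carrier N.
      (\<forall>m\<in>carrier M. \<forall>m'\<in>carrier M. f (m \<oplus>\<^bsub>M\<^esub> m') = f m \<oplus>\<^bsub>N\<^esub> f m') \<and>
      (\<forall>a\<in>carrier A. \<forall>m\<in>carrier M. f (a \<rightharpoonup>\<^bsub>M\<^esub> m) = a \<rightharpoonup>\<^bsub>N\<^esub> f m) \<and>
      (\<forall>a\<in>carrier A. \<forall>m\<in>carrier M. f (m \<leftharpoonup>\<^bsub>M\<^esub> a) = f m \<leftharpoonup>\<^bsub>N\<^esub> a)}"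

text \<open>The sub-bimodules \<open>M 1\<^sub>A\<close> and \<open>1\<^sub>A M\<close>.\<close>

definition right_unital_part :: "('a, 'x) ring_scheme \<Rightarrow> ('a, 'm) bimodule \<Rightarrow> ('a, 'm) bimodule" where
  "right_unital_part A M = M\<lparr>carrier := (\<lambda>m. m \<leftharpoonup>\<^bsub>M\<^esub> \<one>\<^bsub>A\<^esub>) ` carrier M\<rparr>"

definition left_unital_part :: "('a, 'x) ring_scheme \<Rightarrow> ('a, 'm) bimodule \<Rightarrow> ('a, 'm) bimodule" where
  "left_unital_part A M = M\<lparr>carrier := (\<lambda>m. \<one>\<^bsub>A\<^esub> \<rightharpoonup>\<^bsub>M\<^esub> m) ` carrier M\<rparr>"


section \<open>Tensor products over a noncommutative ring\<close>

text \<open>\<open>M \<otimes>\<^sub>A N\<close> is the free abelian group on the set of pairs modulo the subgroup generated by the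
  biadditivity and \<open>A\<close>-balancedness relations. Its elements are cosets, hence sets of formal integer
  combinations of pairs.\<close>

type_synonym ('m, 'n) tensor = "('m \<times> 'n \<Rightarrow>\<^sub>0 int) set"

definition tensor_relators ::
    "('a, 'x) ring_scheme \<Rightarrow> ('a, 'm) bimodule \<Rightarrow> ('a, 'n) bimodule \<Rightarrow> ('m \<times> 'n \<Rightarrow>\<^sub>0 int) set" where
  "tensor_relators A M N =
    {frag_of (m \<oplus>\<^bsub>M\<^esub> m', n) - frag_of (m, n) - frag_of (m', n) | m m' n.
       m \<in> carrier M \<and> m' \<in> carrier M \<and> n \<in> carrier N} \<union>
    {frag_of (m, n \<oplus>\<^bsub>N\<^esub> n') - frag_of (m, n) - frag_of (m, n') | m n n'.
       m \<in> carrier M \<and> n \<in> carrier N \<and> n' \<in> carrier N} \<union>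
    {frag_of (m \<leftharpoonup>\<^bsub>M\<^esub> a, n) - frag_of (m, a \<rightharpoonup>\<^bsub>N\<^esub> n) | m a n.
       m \<in> carrier M \<and> a \<in> carrier A \<and> n \<in> carrier N}"

definition tensor_kernel ::
    "('a, 'x) ring_scheme \<Rightarrow> ('a, 'm) bimodule \<Rightarrow> ('a, 'n) bimodule \<Rightarrow> ('m \<times> 'n \<Rightarrow>\<^sub>0 int) set" where
  "tensor_kernel A M N =
    generate (free_Abelian_group (carrier M \<times> carrier N)) (tensor_relators A M N)"

definition pure_tensor ::
    "('a, 'x) ring_scheme \<Rightarrow> ('a, 'm) bimodule \<Rightarrow> ('a, 'n) bimodule \<Rightarrow> 'm \<Rightarrow> 'n \<Rightarrow> ('m, 'n) tensor" where
  "pure_tensor A M N m n =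
    tensor_kernel A M N #>\<^bsub>free_Abelian_group (carrier M \<times> carrier N)\<^esub> frag_of (m, n)"

definition tensor_group ::
    "('a, 'x) ring_scheme \<Rightarrow> ('a, 'm) bimodule \<Rightarrow> ('a, 'n) bimodule \<Rightarrow> ('m, 'n) tensor ring" where
  "tensor_group A M N =
    (let Q = free_Abelian_group (carrier M \<times> carrier N) Mod tensor_kernel A M N
     in \<lparr>carrier = carrier Q, monoid.mult = undefined, one = undefined, ring.zero = \<one>\<^bsub>Q\<^esub>, add = monoid.mult Q\<rparr>)"

text \<open>The additive map \<open>m \<otimes> n \<mapsto> f m n\<close> out of a tensor product into an abelian group \<open>G\<close>, meaningful
  when \<open>f\<close> is biadditive and balanced: then the sum below takes the same value on all
  representatives of the coset \<open>t\<close>.\<close>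

definition tensor_lift ::
    "('g, 'z) ring_scheme \<Rightarrow> ('m \<Rightarrow> 'n \<Rightarrow> 'g) \<Rightarrow> ('m, 'n) tensor \<Rightarrow> 'g" where
  "tensor_lift G f t =
    the_elem ((\<lambda>x. \<Oplus>\<^bsub>G\<^esub>p\<in>Poly_Mapping.keys x. [Poly_Mapping.lookup x p] \<cdot>\<^bsub>G\<^esub> f (fst p) (snd p)) ` t)"

definition tensor ::
    "('a, 'x) ring_scheme \<Rightarrow> ('a, 'm) bimodule \<Rightarrow> ('a, 'n) bimodule \<Rightarrow> ('a, ('m, 'n) tensor) bimodule" where
  "tensor A M N =
    \<lparr>carrier = carrier (tensor_group A M N), monoid.mult = undefined, one = undefined,
     ring.zero = \<zero>\<^bsub>tensor_group A M N\<^esub>, add = add (tensor_group A M N),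
     lact = (\<lambda>a. tensor_lift (tensor_group A M N) (\<lambda>m n. pure_tensor A M N (a \<rightharpoonup>\<^bsub>M\<^esub> m) n)),
     ract = (\<lambda>t a. tensor_lift (tensor_group A M N) (\<lambda>m n. pure_tensor A M N m (n \<leftharpoonup>\<^bsub>N\<^esub> a)) t)\<rparr>"

text \<open>\<open>f \<otimes>\<^sub>A g\<close> with values in \<open>M' \<otimes>\<^sub>A N'\<close>.\<close>

definition tensor_map ::
    "('a, 'x) ring_scheme \<Rightarrow> ('a, 'm2) bimodule \<Rightarrow> ('a, 'n2) bimodule
     \<Rightarrow> ('m \<Rightarrow> 'm2) \<Rightarrow> ('n \<Rightarrow> 'n2) \<Rightarrow> ('m, 'n) tensor \<Rightarrow> ('m2, 'n2) tensor" where
  "tensor_map A M' N' f g =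
    tensor_lift (tensor A M' N') (\<lambda>m n. pure_tensor A M' N' (f m) (g n))"

text \<open>The associator \<open>(M \<otimes>\<^sub>A N) \<otimes>\<^sub>A P \<rightarrow> M \<otimes>\<^sub>A (N \<otimes>\<^sub>A P)\<close>.\<close>

definition tensor_assoc ::
    "('a, 'x) ring_scheme \<Rightarrow> ('a, 'm) bimodule \<Rightarrow> ('a, 'n) bimodule \<Rightarrow> ('a, 'p) bimodule
     \<Rightarrow> (('m, 'n) tensor, 'p) tensor \<Rightarrow> ('m, ('n, 'p) tensor) tensor" where
  "tensor_assoc A M N P =
    tensor_lift (tensor A M (tensor A N P))
      (\<lambda>t p. tensor_lift (tensor A M (tensor A N P))
        (\<lambda>m n. pure_tensor A M (tensor A N P) m (pure_tensor A N P n p)) t)"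


section \<open>Corings and their lax and weak versions\<close>

text \<open>In the counit axioms, \<open>tensor_lift C (\<lambda>x y. \<epsilon> x \<rightharpoonup> y) (\<Delta> c)\<close> is \<open>\<epsilon>(c\<^sub>1) c\<^sub>2\<close> in Sweedler notation,
  and \<open>tensor_lift C (\<lambda>x y. x \<leftharpoonup> \<epsilon> y) (\<Delta> c)\<close> is \<open>c\<^sub>1 \<epsilon>(c\<^sub>2)\<close>.\<close>

locale coring_data = bimodule A C
  for A :: "('a, 'x) ring_scheme" (structure) and C :: "('a, 'c) bimodule" (structure)
    and \<Delta> :: "'c \<Rightarrow> ('c, 'c) tensor" and \<epsilon> :: "'c \<Rightarrow> 'a" +
  assumes comult_hom: "\<Delta> \<in> bimodule_hom A C (tensor A C C)"
    and counit_hom: "\<epsilon> \<in> bimodule_hom A C (regular_bimodule A)"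
    and coassoc: "c \<in> carrier C \<Longrightarrow>
      tensor_assoc A C C C (tensor_map A (tensor A C C) C \<Delta> id (\<Delta> c)) =
      tensor_map A C (tensor A C C) id \<Delta> (\<Delta> c)"

locale left_unital_lax_coring = coring_data A C \<Delta> \<epsilon>
  for A :: "('a, 'x) ring_scheme" (structure) and C :: "('a, 'c) bimodule" (structure) and \<Delta> \<epsilon> +
  assumes left_unital: "left_unital A C"
    and lax_counit_left: "c \<in> carrier (right_unital_part A C) \<Longrightarrow>
      tensor_lift C (\<lambda>x y. \<epsilon> x \<rightharpoonup>\<^bsub>C\<^esub> y) (\<Delta> c) = c"
    and lax_counit_right: "c \<in> carrier (right_unital_part A C) \<Longrightarrow>
      tensor_lift C (\<lambda>x y. x \<leftharpoonup>\<^bsub>C\<^esub> \<epsilon> y) (\<Delta> c) = c"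

locale left_unital_weak_coring = coring_data A C \<Delta> \<epsilon>
  for A :: "('a, 'x) ring_scheme" (structure) and C :: "('a, 'c) bimodule" (structure) and \<Delta> \<epsilon> +
  assumes left_unital: "left_unital A C"
    and weak_counit_left: "c \<in> carrier C \<Longrightarrow>
      tensor_lift C (\<lambda>x y. \<epsilon> x \<rightharpoonup>\<^bsub>C\<^esub> y) (\<Delta> c) = c \<leftharpoonup>\<^bsub>C\<^esub> \<one>\<^bsub>A\<^esub>"
    and weak_counit_right: "c \<in> carrier C \<Longrightarrow>
      tensor_lift C (\<lambda>x y. x \<leftharpoonup>\<^bsub>C\<^esub> \<epsilon> y) (\<Delta> c) = c \<leftharpoonup>\<^bsub>C\<^esub> \<one>\<^bsub>A\<^esub>"

text \<open>The restriction of \<open>\<Delta>\<close> to \<open>C 1\<^sub>A \<rightarrow> C 1\<^sub>A \<otimes>\<^sub>A C 1\<^sub>A\<close>: the canonical map from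
  \<open>C 1\<^sub>A \<otimes>\<^sub>A C 1\<^sub>A\<close> to \<open>C \<otimes>\<^sub>A C\<close> is (split) injective and, \<open>C\<close> being left unital, its image
  contains \<open>\<Delta>(C 1\<^sub>A)\<close>; \<open>\<Delta>\<close> is composed with its inverse.\<close>

definition restricted_comult ::
    "('a, 'x) ring_scheme \<Rightarrow> ('a, 'c) bimodule \<Rightarrow> ('c \<Rightarrow> ('c, 'c) tensor) \<Rightarrow> 'c \<Rightarrow> ('c, 'c) tensor" where
  "restricted_comult A C \<Delta> c =
    inv_into (carrier (tensor A (right_unital_part A C) (right_unital_part A C)))
      (tensor_map A C C id id) (\<Delta> c)"


section \<open>Rings over \<open>A\<close> and their lax and weak versions\<close>

locale A_ring_data = bimodule A R
  for A :: "('a, 'x) ring_scheme" (structure) and R :: "('a, 'r) bimodule" (structure)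
    and \<mu> :: "('r, 'r) tensor \<Rightarrow> 'r" and \<eta> :: "'a \<Rightarrow> 'r" +
  assumes mu_hom: "\<mu> \<in> bimodule_hom A (tensor A R R) R"
    and eta_hom: "\<eta> \<in> bimodule_hom A (regular_bimodule A) R"
    and mu_assoc: "\<lbrakk>r \<in> carrier R; s \<in> carrier R; t \<in> carrier R\<rbrakk> \<Longrightarrow>
      \<mu> (pure_tensor A R R (\<mu> (pure_tensor A R R r s)) t) =
      \<mu> (pure_tensor A R R r (\<mu> (pure_tensor A R R s t)))"

locale A_ring = A_ring_data A R \<mu> \<eta>
  for A :: "('a, 'x) ring_scheme" (structure) and R :: "('a, 'r) bimodule" (structure) and \<mu> \<eta> +
  assumes left_unital: "left_unital A R"
    and right_unital: "right_unital A R"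
    and unit_left: "r \<in> carrier R \<Longrightarrow> \<mu> (pure_tensor A R R (\<eta> \<one>\<^bsub>A\<^esub>) r) = r"
    and unit_right: "r \<in> carrier R \<Longrightarrow> \<mu> (pure_tensor A R R r (\<eta> \<one>\<^bsub>A\<^esub>)) = r"

locale right_unital_lax_ring = A_ring_data A R \<mu> \<eta>
  for A :: "('a, 'x) ring_scheme" (structure) and R :: "('a, 'r) bimodule" (structure) and \<mu> \<eta> +
  assumes right_unital: "right_unital A R"
    and lax_unit_left: "r \<in> carrier (left_unital_part A R) \<Longrightarrow>
      \<mu> (pure_tensor A R R (\<eta> \<one>\<^bsub>A\<^esub>) r) = r"
    and lax_unit_right: "r \<in> carrier (left_unital_part A R) \<Longrightarrow>
      \<mu> (pure_tensor A R R r (\<eta> \<one>\<^bsub>A\<^esub>)) = r"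

locale right_unital_weak_ring = A_ring_data A R \<mu> \<eta>
  for A :: "('a, 'x) ring_scheme" (structure) and R :: "('a, 'r) bimodule" (structure) and \<mu> \<eta> +
  assumes right_unital: "right_unital A R"
    and weak_unit_left: "r \<in> carrier R \<Longrightarrow>
      \<mu> (pure_tensor A R R (\<eta> \<one>\<^bsub>A\<^esub>) r) = \<one>\<^bsub>A\<^esub> \<rightharpoonup>\<^bsub>R\<^esub> r"
    and weak_unit_right: "r \<in> carrier R \<Longrightarrow>
      \<mu> (pure_tensor A R R r (\<eta> \<one>\<^bsub>A\<^esub>)) = \<one>\<^bsub>A\<^esub> \<rightharpoonup>\<^bsub>R\<^esub> r"

text \<open>The restriction of \<open>\<mu>\<close> to \<open>1\<^sub>A R \<otimes>\<^sub>A 1\<^sub>A R\<close>, that is, its composition with the canonical map to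
  \<open>R \<otimes>\<^sub>A R\<close>. The corestriction of \<open>\<eta>\<close> to \<open>1\<^sub>A R\<close> is the function \<open>\<eta>\<close> itself.\<close>

definition restricted_mult ::
    "('a, 'x) ring_scheme \<Rightarrow> ('a, 'r) bimodule \<Rightarrow> (('r, 'r) tensor \<Rightarrow> 'r) \<Rightarrow> ('r, 'r) tensor \<Rightarrow> 'r" where
  "restricted_mult A R \<mu> = \<mu> \<circ> tensor_map A R R id id"

definition A_ring_iso ::
    "('a, 'x) ring_scheme
     \<Rightarrow> ('a, 'r) bimodule \<Rightarrow> (('r, 'r) tensor \<Rightarrow> 'r) \<Rightarrow> ('a \<Rightarrow> 'r)
     \<Rightarrow> ('a, 's) bimodule \<Rightarrow> (('s, 's) tensor \<Rightarrow> 's) \<Rightarrow> ('a \<Rightarrow> 's) \<Rightarrow> ('r \<Rightarrow> 's) set" where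
  "A_ring_iso A R \<mu> \<eta> S \<nu> \<theta> =
    {\<phi> \<in> bimodule_hom A R S. bij_betw \<phi> (carrier R) (carrier S) \<and>
      (\<forall>r\<in>carrier R. \<forall>s\<in>carrier R.
         \<phi> (\<mu> (pure_tensor A R R r s)) = \<nu> (pure_tensor A S S (\<phi> r) (\<phi> s))) \<and>
      (\<forall>a\<in>carrier A. \<phi> (\<eta> a) = \<theta> a)}"


definition A_rings_isomorphic ::
    "('a, 'x) ring_scheme
     \<Rightarrow> ('a, 'r) bimodule \<Rightarrow> (('r, 'r) tensor \<Rightarrow> 'r) \<Rightarrow> ('a \<Rightarrow> 'r)
     \<Rightarrow> ('a, 's) bimodule \<Rightarrow> (('s, 's) tensor \<Rightarrow> 's) \<Rightarrow> ('a \<Rightarrow> 's) \<Rightarrow> bool" where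
  "A_rings_isomorphic A R \<mu> \<eta> S \<nu> \<theta> \<longleftrightarrow>
    A_ring A R \<mu> \<eta> \<and> A_ring A S \<nu> \<theta> \<and> A_ring_iso A R \<mu> \<eta> S \<nu> \<theta> \<noteq> {}"


section \<open>The left dual\<close>

text \<open>Elements of the dual are extensional functions: they are equal to \<^const>\<open>undefined\<close> outside the carrier of
  \<open>C\<close>, so that equality in the dual is equality on \<open>C\<close>.\<close>

definition left_dual :: "('a, 'x) ring_scheme \<Rightarrow> ('a, 'c) bimodule \<Rightarrow> ('a, 'c \<Rightarrow> 'a) bimodule" where
  "left_dual A C =
    \<lparr>carrier = {f \<in> carrier C \<rightarrow>\<^sub>E carrier A.
       (\<forall>c\<in>carrier C. \<forall>d\<in>carrier C. f (c \<oplus>\<^bsub>C\<^esub> d) = f c \<oplus>\<^bsub>A\<^esub> f d) \<and>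
       (\<forall>a\<in>carrier A. \<forall>c\<in>carrier C. f (a \<rightharpoonup>\<^bsub>C\<^esub> c) = a \<otimes>\<^bsub>A\<^esub> f c)},
     monoid.mult = undefined, one = undefined,
     ring.zero = (\<lambda>c\<in>carrier C. \<zero>\<^bsub>A\<^esub>),
     add = (\<lambda>f g. \<lambda>c\<in>carrier C. f c \<oplus>\<^bsub>A\<^esub> g c),
     lact = (\<lambda>a f. \<lambda>c\<in>carrier C. f (c \<leftharpoonup>\<^bsub>C\<^esub> a)),
     ract = (\<lambda>f b. \<lambda>c\<in>carrier C. f c \<otimes>\<^bsub>A\<^esub> b)\<rparr>"

text \<open>\<open>(f # g)(c) = g(c\<^sub>1 f(c\<^sub>2))\<close>.\<close>

definition dual_conv ::
    "('a, 'c) bimodule \<Rightarrow> ('c \<Rightarrow> ('c, 'c) tensor) \<Rightarrow> ('c \<Rightarrow> 'a) \<Rightarrow> ('c \<Rightarrow> 'a) \<Rightarrow> 'c \<Rightarrow> 'a" where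
  "dual_conv C \<Delta> f g = (\<lambda>c\<in>carrier C. g (tensor_lift C (\<lambda>x y. x \<leftharpoonup>\<^bsub>C\<^esub> f y) (\<Delta> c)))"

definition dual_mult ::
    "('a, 'x) ring_scheme \<Rightarrow> ('a, 'c) bimodule \<Rightarrow> ('c \<Rightarrow> ('c, 'c) tensor)
     \<Rightarrow> ('c \<Rightarrow> 'a, 'c \<Rightarrow> 'a) tensor \<Rightarrow> 'c \<Rightarrow> 'a" where
  "dual_mult A C \<Delta> = tensor_lift (left_dual A C) (dual_conv C \<Delta>)"

definition dual_unit ::
    "('a, 'x) ring_scheme \<Rightarrow> ('a, 'c) bimodule \<Rightarrow> ('c \<Rightarrow> 'a) \<Rightarrow> 'a \<Rightarrow> 'c \<Rightarrow> 'a" where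
  "dual_unit A C \<epsilon> a = (\<lambda>c\<in>carrier C. \<epsilon> c \<otimes>\<^bsub>A\<^esub> a)"

end

theory Submission
  imports Defs
begin

text \<open>The product \<open>f # g = g \<circ> T f\<close> is governed by the left linear maps \<open>T f c = c\<^sub>1 f(c\<^sub>2)\<close>; coassociativity
  amounts to \<open>T g \<circ> T f = T (f # g)\<close>, and hence gives associativity. If \<open>C\<close> is lax then
  \<open>T \<epsilon> c = T (1 \<epsilon>) c = T \<epsilon> (c 1) = c 1\<close> for every \<open>c\<close>, and \<open>\<epsilon> (T f c) = f (\<epsilon>(c\<^sub>1) c\<^sub>2)\<close>, which yields the unit
  laws. The isomorphism is restriction of functionals from \<open>C\<close> to \<open>C 1\<close>, with inverse
  \<open>h \<mapsto> (c \<mapsto> h (c 1))\<close>. The ring structure on the dual of \<open>C 1\<close> is obtained by transport along this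
  bijection, so that the only fact needed about the restricted comultiplication is that \<open>\<Delta>\<close> maps
  \<open>C 1\<close> into the image of \<open>C 1 \<otimes> C 1\<close>.\<close>

section \<open>Evaluating formal integer combinations\<close>

text \<open>Right multiplication by \<open>\<one>\<close> is an idempotent of \<open>C\<close>, in
  general not the identity. On functionals it becomes the left action of \<open>\<one>\<close>,
  \<open>(1 f)(c) = f (c 1)\<close>, so the unital part of the dual consists of the functionals with
  the same value at \<open>c\<close> and at \<open>c 1\<close>. This is how lax axioms, which speak
  of \<open>C 1\<close> only, control all of \<open>C\<close>: the unit functional lies in that part
  because \<open>\<epsilon> (c 1) = \<epsilon> c\<close>. Hence the left unit law takes the form
  \<open>1 f\<close> on the whole dual already in the lax case. The right unit law contracts with
  \<open>f\<close> itself; there the lax case uses \<open>f = 1 f\<close>, whereas the weak axiom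
  yields \<open>f (c 1)\<close> directly. The formal obstacle is that tensors are cosets and every
  Sweedler expression is a lift, with a meaning only after its integrand has been shown balanced.
  Identities between such expressions are additive in the tensor and are therefore settled on pure
  tensors. The restricted comultiplication is a chosen preimage of \<open>\<Delta> c\<close>;
  contractions over \<open>C 1\<close> factor through the map to \<open>C \<otimes> C\<close>, so
  they depend on \<open>\<Delta> c\<close> alone.\<close>

definition frag_eval :: "('g, 'z) ring_scheme \<Rightarrow> ('p \<Rightarrow> 'g) \<Rightarrow> ('p \<Rightarrow>\<^sub>0 int) \<Rightarrow> 'g" where
  "frag_eval G g x = (\<Oplus>\<^bsub>G\<^esub>p\<in>Poly_Mapping.keys x. [Poly_Mapping.lookup x p] \<cdot>\<^bsub>G\<^esub> g p)"

lemma add_pow_int_zero: "[(0 :: int)] \<cdot>\<^bsub>G\<^esub> x = \<zero>\<^bsub>G\<^esub>"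
  by (simp add: add_pow_def int_pow_def2)

text \<open>Cancellation can make the support of a sum smaller than the union of the supports. Zero
  coefficients contribute zero, so sums over different supports can be moved to a common finite
  index set.\<close>

lemma frag_eval_superset:
  assumes "abelian_group G" "finite K" "Poly_Mapping.keys x \<subseteq> K" "g \<in> K \<rightarrow> carrier G"
  shows "frag_eval G g x = (\<Oplus>\<^bsub>G\<^esub>p\<in>K. [Poly_Mapping.lookup x p] \<cdot>\<^bsub>G\<^esub> g p)"
proof -
  interpret abelian_group G by fact
  show ?thesis
    unfolding frag_eval_def
    by (rule add.finprod_mono_neutral_cong_left)
      (use assms in \<open>auto simp: in_keys_iff Pi_iff add_pow_int_zero\<close>)
qed

lemma frag_eval_closed:
  assumes "abelian_group G" "Poly_Mapping.keys x \<subseteq> S" "g \<in> S \<rightarrow> carrier G"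
  shows "frag_eval G g x \<in> carrier G"
proof -
  interpret abelian_group G by fact
  show ?thesis
    unfolding frag_eval_def by (rule finsum_closed) (use assms in auto)
qed

lemma frag_eval_add:
  assumes G: "abelian_group G" and K: "Poly_Mapping.keys x \<subseteq> S" "Poly_Mapping.keys y \<subseteq> S"
    and g: "g \<in> S \<rightarrow> carrier G"
  shows "frag_eval G g (x + y) = frag_eval G g x \<oplus>\<^bsub>G\<^esub> frag_eval G g y"
proof -
  interpret abelian_group G by fact
  let ?K = "Poly_Mapping.keys x \<union> Poly_Mapping.keys y"
  have gK: "g \<in> ?K \<rightarrow> carrier G" using K g by auto
  have "frag_eval G g (x + y) = (\<Oplus>\<^bsub>G\<^esub>p\<in>?K. [Poly_Mapping.lookup (x + y) p] \<cdot>\<^bsub>G\<^esub> g p)"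
    by (rule frag_eval_superset) (use G gK keys_add[of x y] in auto)
  also have "\<dots> = (\<Oplus>\<^bsub>G\<^esub>p\<in>?K. [Poly_Mapping.lookup x p] \<cdot>\<^bsub>G\<^esub> g p \<oplus>\<^bsub>G\<^esub> [Poly_Mapping.lookup y p] \<cdot>\<^bsub>G\<^esub> g p)"
    by (rule finsum_cong') (use gK in \<open>auto simp: lookup_add add.int_pow_mult Pi_iff\<close>)
  also have "\<dots> = (\<Oplus>\<^bsub>G\<^esub>p\<in>?K. [Poly_Mapping.lookup x p] \<cdot>\<^bsub>G\<^esub> g p) \<oplus>\<^bsub>G\<^esub> (\<Oplus>\<^bsub>G\<^esub>p\<in>?K. [Poly_Mapping.lookup y p] \<cdot>\<^bsub>G\<^esub> g p)"
    by (rule finsum_addf) (use gK in \<open>auto simp: Pi_iff\<close>)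
  also have "\<dots> = frag_eval G g x \<oplus>\<^bsub>G\<^esub> frag_eval G g y"
    using frag_eval_superset[OF G, of ?K x g] frag_eval_superset[OF G, of ?K y g] gK by auto
  finally show ?thesis .
qed

lemma frag_eval_of:
  assumes "abelian_group G" "g p \<in> carrier G"
  shows "frag_eval G g (frag_of p) = g p"
proof -
  interpret abelian_group G by fact
  show ?thesis using assms by (simp add: frag_eval_def)
qed

lemma frag_eval_zero:
  assumes "abelian_group G"
  shows "frag_eval G g 0 = \<zero>\<^bsub>G\<^esub>"
proof -
  interpret abelian_group G by fact
  show ?thesis by (simp add: frag_eval_def)
qed

lemma frag_eval_uminus:
  assumes G: "abelian_group G" and K: "Poly_Mapping.keys x \<subseteq> S" and g: "g \<in> S \<rightarrow> carrier G"
  shows "frag_eval G g (- x) = \<ominus>\<^bsub>G\<^esub> frag_eval G g x"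
proof -
  interpret abelian_group G by fact
  have "frag_eval G g (- x) \<oplus>\<^bsub>G\<^esub> frag_eval G g x = \<zero>\<^bsub>G\<^esub>"
    using frag_eval_add[OF G _ K g, of "- x"] K by (simp add: frag_eval_zero[OF G])
  then show ?thesis
    using frag_eval_closed[OF G K g] frag_eval_closed[OF G _ g, of "- x"] K
    by (simp add: minus_equality)
qed

lemma frag_eval_diff:
  assumes G: "abelian_group G" and K: "Poly_Mapping.keys x \<subseteq> S" "Poly_Mapping.keys y \<subseteq> S"
    and g: "g \<in> S \<rightarrow> carrier G"
  shows "frag_eval G g (x - y) = frag_eval G g x \<ominus>\<^bsub>G\<^esub> frag_eval G g y"
  using frag_eval_add[OF G K(1) _ g, of "- y"] frag_eval_uminus[OF G K(2) g] K(2)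
  by (simp add: a_minus_def)

section \<open>Tensor products\<close>

lemma keys_diff_subset:
  "\<lbrakk>Poly_Mapping.keys x \<subseteq> S; Poly_Mapping.keys y \<subseteq> S\<rbrakk> \<Longrightarrow> Poly_Mapping.keys (x - y :: 'p \<Rightarrow>\<^sub>0 int) \<subseteq> S"
  using keys_diff[of x y] by blast

lemma tensor_relators_subset:
  assumes "bimodule A M" "bimodule A N"
  shows "tensor_relators A M N \<subseteq> carrier (free_Abelian_group (carrier M \<times> carrier N))"
proof -
  interpret M: bimodule A M by fact
  interpret N: bimodule A N by fact
  have "Poly_Mapping.keys x \<subseteq> carrier M \<times> carrier N" if "x \<in> tensor_relators A M N" for x
    using that unfolding tensor_relators_def
    by (elim UnE CollectE exE conjE) (simp_all add: M.ract_closed N.lact_closed keys_diff_subset)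
  then show ?thesis by auto
qed

lemma tensor_kernel_normal:
  assumes "bimodule A M" "bimodule A N"
  shows "tensor_kernel A M N \<lhd> free_Abelian_group (carrier M \<times> carrier N)"
  unfolding tensor_kernel_def
  by (intro comm_group.normal_iff_subgroup[THEN iffD2] abelian_free_Abelian_group
      group.generate_is_subgroup group_free_Abelian_group tensor_relators_subset assms)

lemma tensor_group_simps:
  "carrier (tensor_group A M N) = (\<lambda>x. tensor_kernel A M N #>\<^bsub>free_Abelian_group (carrier M \<times> carrier N)\<^esub> x)
     ` carrier (free_Abelian_group (carrier M \<times> carrier N))"
  "\<zero>\<^bsub>tensor_group A M N\<^esub> = tensor_kernel A M N"
  "add (tensor_group A M N) = set_mult (free_Abelian_group (carrier M \<times> carrier N))"
  by (simp_all add: tensor_group_def Let_def carrier_FactGroup)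

lemma tensor_simps:
  "carrier (tensor A M N) = carrier (tensor_group A M N)"
  "\<zero>\<^bsub>tensor A M N\<^esub> = \<zero>\<^bsub>tensor_group A M N\<^esub>"
  "add (tensor A M N) = add (tensor_group A M N)"
  by (simp_all add: tensor_def)

lemma add_monoid_tensor_group:
  "add_monoid (tensor_group A M N) = free_Abelian_group (carrier M \<times> carrier N) Mod tensor_kernel A M N"
  by (simp add: tensor_group_def Let_def FactGroup_def)

lemma tensor_abelian_group:
  assumes "bimodule A M" "bimodule A N"
  shows "abelian_group (tensor_group A M N)"
proof -
  have "comm_group (add_monoid (tensor_group A M N))"
    unfolding add_monoid_tensor_group
    by (intro comm_group.abelian_FactGroup abelian_free_Abelian_group normal_imp_subgroup
        tensor_kernel_normal assms)
  then show ?thesis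
    by (simp add: abelian_group_axioms_def abelian_group_def abelian_monoid_def comm_group_def)
qed

lemma abelian_group_cong:
  fixes G :: "('g, 'z) ring_scheme" and H :: "('g, 'w) ring_scheme"
  assumes "abelian_group G" "carrier H = carrier G" "add H = add G" "\<zero>\<^bsub>H\<^esub> = \<zero>\<^bsub>G\<^esub>"
  shows "abelian_group H"
proof -
  note E = abelian_groupE[OF assms(1)]
  show ?thesis
    by (rule abelian_groupI) (use E in \<open>simp_all add: assms(2-4)\<close>)
qed

lemma tensor_coset_add:
  assumes "bimodule A M" "bimodule A N"
    and "Poly_Mapping.keys x \<subseteq> carrier M \<times> carrier N" "Poly_Mapping.keys y \<subseteq> carrier M \<times> carrier N"
  shows "(tensor_kernel A M N #>\<^bsub>free_Abelian_group (carrier M \<times> carrier N)\<^esub> x) \<oplus>\<^bsub>tensor_group A M N\<^esub>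
      (tensor_kernel A M N #>\<^bsub>free_Abelian_group (carrier M \<times> carrier N)\<^esub> y) =
      tensor_kernel A M N #>\<^bsub>free_Abelian_group (carrier M \<times> carrier N)\<^esub> (x + y)"
  using normal.rcos_sum[OF tensor_kernel_normal[OF assms(1,2)], of x y] assms(3,4)
  by (simp add: tensor_group_simps)

lemma tensor_coset_eqI:
  assumes "bimodule A M" "bimodule A N"
    and "Poly_Mapping.keys x \<subseteq> carrier M \<times> carrier N" "Poly_Mapping.keys y \<subseteq> carrier M \<times> carrier N"
    and "x - y \<in> tensor_kernel A M N"
  shows "tensor_kernel A M N #>\<^bsub>free_Abelian_group (carrier M \<times> carrier N)\<^esub> x =
      tensor_kernel A M N #>\<^bsub>free_Abelian_group (carrier M \<times> carrier N)\<^esub> y"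
proof -
  let ?F = "free_Abelian_group (carrier M \<times> carrier N)"
  let ?K = "tensor_kernel A M N"
  interpret F: group ?F by simp
  interpret K: normal ?K ?F by (rule tensor_kernel_normal) fact+
  have "x \<in> ?K #>\<^bsub>?F\<^esub> y"
    unfolding r_coset_def using assms(5) by force
  then show ?thesis
    by (metis F.repr_independence K.is_subgroup assms(4) carrier_free_Abelian_group_iff)
qed

lemma tensor_group_carrierE:
  assumes "t \<in> carrier (tensor_group A M N)"
  obtains x where "Poly_Mapping.keys x \<subseteq> carrier M \<times> carrier N"
    "t = tensor_kernel A M N #>\<^bsub>free_Abelian_group (carrier M \<times> carrier N)\<^esub> x"
  using assms by (auto simp: tensor_group_simps)

section \<open>The universal property of the tensor product\<close>

locale balanced_map =
  M: bimodule A M + N: bimodule A N + G: abelian_group G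
  for A :: "('a, 'x) ring_scheme" and M :: "('a, 'm) bimodule" and N :: "('a, 'n) bimodule"
    and G :: "('g, 'z) ring_scheme" and f :: "'m \<Rightarrow> 'n \<Rightarrow> 'g" +
  assumes closed: "\<lbrakk>m \<in> carrier M; n \<in> carrier N\<rbrakk> \<Longrightarrow> f m n \<in> carrier G"
    and add_left: "\<lbrakk>m \<in> carrier M; m' \<in> carrier M; n \<in> carrier N\<rbrakk>
      \<Longrightarrow> f (m \<oplus>\<^bsub>M\<^esub> m') n = f m n \<oplus>\<^bsub>G\<^esub> f m' n"
    and add_right: "\<lbrakk>m \<in> carrier M; n \<in> carrier N; n' \<in> carrier N\<rbrakk>
      \<Longrightarrow> f m (n \<oplus>\<^bsub>N\<^esub> n') = f m n \<oplus>\<^bsub>G\<^esub> f m n'"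
    and balanced: "\<lbrakk>m \<in> carrier M; a \<in> carrier A; n \<in> carrier N\<rbrakk>
      \<Longrightarrow> f (m \<leftharpoonup>\<^bsub>M\<^esub> a) n = f m (a \<rightharpoonup>\<^bsub>N\<^esub> n)"
begin

abbreviation F where "F \<equiv> free_Abelian_group (carrier M \<times> carrier N)"
abbreviation K where "K \<equiv> tensor_kernel A M N"
abbreviation ev where "ev \<equiv> frag_eval G (\<lambda>p. f (fst p) (snd p))"

lemma eval_closed: "(\<lambda>p. f (fst p) (snd p)) \<in> carrier M \<times> carrier N \<rightarrow> carrier G"
  using closed by auto

lemmas ev_diff = frag_eval_diff[OF G.abelian_group_axioms _ _ eval_closed]
lemmas ev_add = frag_eval_add[OF G.abelian_group_axioms _ _ eval_closed]

lemma diff_summands: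
  assumes "x \<in> carrier G" "y \<in> carrier G"
  shows "x \<oplus>\<^bsub>G\<^esub> y \<ominus>\<^bsub>G\<^esub> x \<ominus>\<^bsub>G\<^esub> y = \<zero>\<^bsub>G\<^esub>"
proof -
  have "x \<oplus>\<^bsub>G\<^esub> y \<ominus>\<^bsub>G\<^esub> x \<ominus>\<^bsub>G\<^esub> y = (x \<oplus>\<^bsub>G\<^esub> y) \<oplus>\<^bsub>G\<^esub> \<ominus>\<^bsub>G\<^esub> (x \<oplus>\<^bsub>G\<^esub> y)"
    using assms by (simp add: a_minus_def G.minus_add G.a_assoc del: G.r_neg)
  then show ?thesis using assms G.r_neg[of "x \<oplus>\<^bsub>G\<^esub> y"] by simp
qed

lemma ev_relators:
  assumes "x \<in> tensor_relators A M N"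
  shows "ev x = \<zero>\<^bsub>G\<^esub>"
  using assms unfolding tensor_relators_def
  by (auto simp: ev_diff keys_diff_subset frag_eval_of[OF G.abelian_group_axioms] closed add_left
      add_right balanced M.ract_closed N.lact_closed diff_summands)
   (simp add: a_minus_def G.r_neg closed N.lact_closed)

lemma ev_kernel:
  assumes "x \<in> K"
  shows "ev x = \<zero>\<^bsub>G\<^esub>"
proof -
  note rel = tensor_relators_subset[OF M.bimodule_axioms N.bimodule_axioms]
  \<comment> \<open>The support condition travels through the induction because \<open>ev\<close> is
    additive only on combinations supported in the carriers.\<close>
  have "Poly_Mapping.keys x \<subseteq> carrier M \<times> carrier N \<and> ev x = \<zero>\<^bsub>G\<^esub>"
    using assms unfolding tensor_kernel_def
  proof (induction rule: generate.induct)
    case one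
    then show ?case by (simp add: frag_eval_zero[OF G.abelian_group_axioms])
  next
    case (incl h)
    then show ?case using ev_relators rel by force
  next
    case (inv h)
    then show ?case using ev_relators rel
      by (subst inv_free_Abelian_group)
        (auto dest!: subsetD[of _ _ h] simp: frag_eval_uminus[OF G.abelian_group_axioms _ eval_closed])
  next
    case (eng h1 h2)
    then show ?case using keys_add[of h1 h2] by (auto simp: ev_add)
  qed
  then show ?thesis ..
qed

lemma kernel_subset: "K \<subseteq> {x. Poly_Mapping.keys x \<subseteq> carrier M \<times> carrier N}"
  using normal_imp_subgroup[OF tensor_kernel_normal[OF M.bimodule_axioms N.bimodule_axioms], THEN subgroup.subset]
  by (auto simp: subset_iff)

text \<open>The members of the coset are \<open>k + x\<close> with \<open>k\<close> in the kernel,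
  where \<open>ev\<close> vanishes. The image in \<open>tensor_lift\<close> is therefore a singleton
  and \<open>the_elem\<close> is well defined.\<close>

lemma lift_coset:
  assumes "Poly_Mapping.keys x \<subseteq> carrier M \<times> carrier N"
  shows "tensor_lift G f (K #>\<^bsub>F\<^esub> x) = ev x"
proof -
  have "0 \<in> K"
    using subgroup.one_closed[OF normal_imp_subgroup[OF tensor_kernel_normal[OF M.bimodule_axioms N.bimodule_axioms]]]
    by simp
  moreover have "ev (k + x) = ev x" if "k \<in> K" for k
    using that assms kernel_subset ev_kernel[OF that] frag_eval_closed[OF G.abelian_group_axioms assms eval_closed]
    by (subst ev_add) auto
  ultimately have "ev ` (K #>\<^bsub>F\<^esub> x) = {ev x}"
    unfolding r_coset_def by (auto simp: image_iff) 
  then show ?thesis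
    unfolding tensor_lift_def frag_eval_def by simp
qed

lemma lift_closed:
  assumes "t \<in> carrier (tensor A M N)"
  shows "tensor_lift G f t \<in> carrier G"
  using assms
  by (auto elim!: tensor_group_carrierE
      simp: tensor_simps lift_coset frag_eval_closed[OF G.abelian_group_axioms _ eval_closed])

lemma lift_add:
  assumes "s \<in> carrier (tensor A M N)" "t \<in> carrier (tensor A M N)"
  shows "tensor_lift G f (s \<oplus>\<^bsub>tensor A M N\<^esub> t) = tensor_lift G f s \<oplus>\<^bsub>G\<^esub> tensor_lift G f t"
proof -
  obtain x where x: "Poly_Mapping.keys x \<subseteq> carrier M \<times> carrier N" "s = K #>\<^bsub>F\<^esub> x"
    using assms(1)[unfolded tensor_simps] by (rule tensor_group_carrierE)
  obtain y where y: "Poly_Mapping.keys y \<subseteq> carrier M \<times> carrier N" "t = K #>\<^bsub>F\<^esub> y"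
    using assms(2)[unfolded tensor_simps] by (rule tensor_group_carrierE)
  have "Poly_Mapping.keys (x + y) \<subseteq> carrier M \<times> carrier N"
    using x y keys_add[of x y] by auto
  then show ?thesis
    using x y
    by (simp add: tensor_simps tensor_coset_add[OF M.bimodule_axioms N.bimodule_axioms] lift_coset ev_add)
qed

lemma lift_pure:
  assumes "m \<in> carrier M" "n \<in> carrier N"
  shows "tensor_lift G f (pure_tensor A M N m n) = f m n"
  using assms unfolding pure_tensor_def
  by (simp add: lift_coset frag_eval_of[OF G.abelian_group_axioms] closed)

end

text \<open>Each law says that one of the three families of relators vanishes in the quotient. The
  codomain is \<open>tensor_group\<close> because the actions of \<open>tensor\<close> are
  themselves lifts into it and become available only afterwards.\<close>

lemma pure_tensor_balanced_map:
  assumes "bimodule A M" "bimodule A N"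
  shows "balanced_map A M N (tensor_group A M N) (pure_tensor A M N)"
proof -
  interpret M: bimodule A M by fact
  interpret N: bimodule A N by fact
  interpret T: abelian_group "tensor_group A M N" by (rule tensor_abelian_group) fact+
  have r: "x \<in> tensor_relators A M N \<Longrightarrow> x \<in> tensor_kernel A M N" for x
    unfolding tensor_kernel_def by (rule generate.incl)
  have sum: "pure_tensor A M N m n =
      pure_tensor A M N m1 n1 \<oplus>\<^bsub>tensor_group A M N\<^esub> pure_tensor A M N m2 n2"
    if "frag_of (m, n) - frag_of (m1, n1) - frag_of (m2, n2) \<in> tensor_kernel A M N"
      "(m, n) \<in> carrier M \<times> carrier N" "(m1, n1) \<in> carrier M \<times> carrier N"
      "(m2, n2) \<in> carrier M \<times> carrier N"
    for m n m1 n1 m2 n2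
  proof -
    have "Poly_Mapping.keys (frag_of (m1, n1) + frag_of (m2, n2)) \<subseteq> carrier M \<times> carrier N"
      using that(3,4) keys_add[of "frag_of (m1, n1)" "frag_of (m2, n2)"] by auto
    then show ?thesis
      unfolding pure_tensor_def
      by (subst tensor_coset_add[OF assms])
        (use that in \<open>simp_all add: tensor_coset_eqI[OF assms] diff_diff_eq\<close>)
  qed
  show ?thesis
  proof unfold_locales
    fix m n assume "m \<in> carrier M" "n \<in> carrier N"
    then show "pure_tensor A M N m n \<in> carrier (tensor_group A M N)"
      by (simp add: tensor_group_simps pure_tensor_def)
  next
    fix m m' n assume *: "m \<in> carrier M" "m' \<in> carrier M" "n \<in> carrier N"
    have "frag_of (m \<oplus>\<^bsub>M\<^esub> m', n) - frag_of (m, n) - frag_of (m', n) \<in> tensor_kernel A M N"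
      by (rule r) (use * in \<open>force simp: tensor_relators_def\<close>)
    then show "pure_tensor A M N (m \<oplus>\<^bsub>M\<^esub> m') n =
        pure_tensor A M N m n \<oplus>\<^bsub>tensor_group A M N\<^esub> pure_tensor A M N m' n"
      by (rule sum) (use * in auto)
  next
    fix m n n' assume *: "m \<in> carrier M" "n \<in> carrier N" "n' \<in> carrier N"
    have "frag_of (m, n \<oplus>\<^bsub>N\<^esub> n') - frag_of (m, n) - frag_of (m, n') \<in> tensor_kernel A M N"
      by (rule r) (use * in \<open>force simp: tensor_relators_def\<close>)
    then show "pure_tensor A M N m (n \<oplus>\<^bsub>N\<^esub> n') =
        pure_tensor A M N m n \<oplus>\<^bsub>tensor_group A M N\<^esub> pure_tensor A M N m n'"
      by (rule sum) (use * in auto)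
  next
    fix m a n assume *: "m \<in> carrier M" "a \<in> carrier A" "n \<in> carrier N"
    have "frag_of (m \<leftharpoonup>\<^bsub>M\<^esub> a, n) - frag_of (m, a \<rightharpoonup>\<^bsub>N\<^esub> n) \<in> tensor_kernel A M N"
      by (rule r) (use * in \<open>force simp: tensor_relators_def\<close>)
    then show "pure_tensor A M N (m \<leftharpoonup>\<^bsub>M\<^esub> a) n = pure_tensor A M N m (a \<rightharpoonup>\<^bsub>N\<^esub> n)"
      using * assms unfolding pure_tensor_def
      by (intro tensor_coset_eqI) (auto simp: M.ract_closed N.lact_closed)
  qed
qed

text \<open>No case for negatives appears, since a sign is absorbed by the first factor:
  \<open>-(m \<otimes> n) = (-m) \<otimes> n\<close>. Likewise zero is the pure tensor of two
  zeros.\<close>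

lemma tensor_induct [consumes 3, case_names pure add]:
  assumes MN: "bimodule A M" "bimodule A N" and "t \<in> carrier (tensor A M N)"
    and pure: "\<And>m n. \<lbrakk>m \<in> carrier M; n \<in> carrier N\<rbrakk> \<Longrightarrow> P (pure_tensor A M N m n)"
    and "\<And>s t. \<lbrakk>s \<in> carrier (tensor A M N); t \<in> carrier (tensor A M N); P s; P t\<rbrakk>
      \<Longrightarrow> P (s \<oplus>\<^bsub>tensor A M N\<^esub> t)"
  shows "P t"
proof -
  note t = assms(3)[unfolded tensor_simps] and add = assms(5)[unfolded tensor_simps]
  interpret M: bimodule A M by fact
  interpret N: bimodule A N by fact
  interpret T: abelian_group "tensor_group A M N" by (rule tensor_abelian_group) fact+
  interpret B: balanced_map A M N "tensor_group A M N" "pure_tensor A M N"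
    by (rule pure_tensor_balanced_map) fact+
  have zero_left: "pure_tensor A M N \<zero>\<^bsub>M\<^esub> n = \<zero>\<^bsub>tensor_group A M N\<^esub>" if "n \<in> carrier N" for n
    using B.add_left[of "\<zero>\<^bsub>M\<^esub>" "\<zero>\<^bsub>M\<^esub>" n] that B.closed[of "\<zero>\<^bsub>M\<^esub>" n] by simp
  have neg: "P (\<ominus>\<^bsub>tensor_group A M N\<^esub> pure_tensor A M N m n)" if "m \<in> carrier M" "n \<in> carrier N" for m n
  proof -
    have "\<ominus>\<^bsub>tensor_group A M N\<^esub> pure_tensor A M N m n = pure_tensor A M N (\<ominus>\<^bsub>M\<^esub> m) n"
      using that B.add_left[of "\<ominus>\<^bsub>M\<^esub> m" m n] zero_left[of n] B.closed[of m n] B.closed[of "\<ominus>\<^bsub>M\<^esub> m" n]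
      by (simp add: M.l_neg T.minus_equality)
    then show ?thesis using pure that by simp
  qed
  obtain x where x: "Poly_Mapping.keys x \<subseteq> carrier M \<times> carrier N" "t = B.K #>\<^bsub>B.F\<^esub> x"
    using t by (rule tensor_group_carrierE)
  let ?c = "\<lambda>x. B.K #>\<^bsub>B.F\<^esub> x"
  have car: "?c x \<in> carrier (tensor_group A M N)" if "Poly_Mapping.keys x \<subseteq> carrier M \<times> carrier N" for x
    using that by (auto simp: tensor_group_simps)
  have dif: "?c (x - y) = ?c x \<ominus>\<^bsub>tensor_group A M N\<^esub> ?c y"
    if "Poly_Mapping.keys x \<subseteq> carrier M \<times> carrier N" "Poly_Mapping.keys y \<subseteq> carrier M \<times> carrier N" for x y
  proof -
    have "?c (x - y) \<oplus>\<^bsub>tensor_group A M N\<^esub> ?c y = ?c x"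
      using that keys_diff_subset[of x _ y] by (simp add: tensor_coset_add[OF MN])
    then show ?thesis
      using that car[of x] car[of y] car[of "x - y"] keys_diff_subset[of x _ y]
      by (metis T.add.inv_solve_right a_minus_def)
  qed
  have zer: "?c 0 = \<zero>\<^bsub>tensor_group A M N\<^esub>"
    using dif[of 0 0] car[of 0] by (simp add: T.r_neg a_minus_def)
  \<comment> \<open>The induction on the free abelian group steps through differences
    \<open>x - y\<close>, which calls for the claim at \<open>-y\<close>; so the claim is
    strengthened to both signs.\<close>
  have "P (?c x) \<and> P (\<ominus>\<^bsub>tensor_group A M N\<^esub> ?c x)"
    using x(1)
  proof (induction rule: free_Abelian_group_induct[consumes 1])
    case 1
    have "P \<zero>\<^bsub>tensor_group A M N\<^esub>"
      using zero_left[of "\<zero>\<^bsub>N\<^esub>"] pure[of "\<zero>\<^bsub>M\<^esub>" "\<zero>\<^bsub>N\<^esub>"] by simp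
    moreover have "\<ominus>\<^bsub>tensor_group A M N\<^esub> \<zero>\<^bsub>tensor_group A M N\<^esub> = \<zero>\<^bsub>tensor_group A M N\<^esub>"
      by (rule T.minus_equality) simp_all
    ultimately show ?case by (simp only: zer simp_thms)
  next
    case (2 x y)
    have "\<ominus>\<^bsub>tensor_group A M N\<^esub> ?c (x - y) = ?c y \<oplus>\<^bsub>tensor_group A M N\<^esub> \<ominus>\<^bsub>tensor_group A M N\<^esub> ?c x"
      using 2 car[of x] car[of y] by (simp add: dif a_minus_def T.minus_add T.a_comm)
    then show ?case using 2 car[of x] car[of y]
      by (simp add: dif a_minus_def add)
  next
    case (3 a)
    then show ?case using pure neg unfolding pure_tensor_def by (cases a) auto
  qed
  then show ?thesis using x by simp
qed

text \<open>Uniqueness in the universal property, stated for arbitrary additive functions so that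
  composites of lifts, actions and structure maps can be compared directly.\<close>

lemma tensor_additive_eqI:
  assumes "bimodule A M" "bimodule A N" "t \<in> carrier (tensor A M N)"
    and "\<And>s t. \<lbrakk>s \<in> carrier (tensor A M N); t \<in> carrier (tensor A M N)\<rbrakk>
      \<Longrightarrow> \<Phi> (s \<oplus>\<^bsub>tensor A M N\<^esub> t) = \<Phi> s \<oplus>\<^bsub>G\<^esub> \<Phi> t"
    and "\<And>s t. \<lbrakk>s \<in> carrier (tensor A M N); t \<in> carrier (tensor A M N)\<rbrakk>
      \<Longrightarrow> \<Psi> (s \<oplus>\<^bsub>tensor A M N\<^esub> t) = \<Psi> s \<oplus>\<^bsub>G\<^esub> \<Psi> t"
    and "\<And>m n. \<lbrakk>m \<in> carrier M; n \<in> carrier N\<rbrakk>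
      \<Longrightarrow> \<Phi> (pure_tensor A M N m n) = \<Psi> (pure_tensor A M N m n)"
  shows "\<Phi> t = \<Psi> t"
proof -
  show ?thesis
    using assms(1-3) by (induction rule: tensor_induct) (use assms(4-6) in auto)
qed

text \<open>\<open>tensor\<close> and \<open>tensor_group\<close> are different records with the
  same additive data; this carries balancedness from one to the other.\<close>

lemma balanced_map_cong_codomain:
  fixes G :: "('g, 'z) ring_scheme" and H :: "('g, 'w) ring_scheme"
  assumes "balanced_map A M N G f" "carrier H = carrier G" "add H = add G" "\<zero>\<^bsub>H\<^esub> = \<zero>\<^bsub>G\<^esub>"
  shows "balanced_map A M N H f"
proof -
  interpret B: balanced_map A M N G f by fact
  interpret H: abelian_group H
    by (rule abelian_group_cong[OF B.G.abelian_group_axioms]) fact+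
  show ?thesis
    by unfold_locales (simp_all add: assms B.closed B.add_left B.add_right B.balanced)
qed

section \<open>The bimodule structure on a tensor product\<close>

locale two_bimodules = M: bimodule A M + N: bimodule A N
  for A :: "('a, 'x) ring_scheme" and M :: "('a, 'm) bimodule" and N :: "('a, 'n) bimodule"
begin

abbreviation T where "T \<equiv> tensor A M N"
abbreviation pure where "pure \<equiv> pure_tensor A M N"

sublocale P: balanced_map A M N T pure
  by (rule balanced_map_cong_codomain[OF pure_tensor_balanced_map])
    (simp_all add: M.bimodule_axioms N.bimodule_axioms tensor_simps)

sublocale PG: balanced_map A M N "tensor_group A M N" pure
  by (rule pure_tensor_balanced_map) (simp_all add: M.bimodule_axioms N.bimodule_axioms)

text \<open>Balancedness is the commutation of the two actions: \<open>a (m b) \<otimes> n = (a m) b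
  \<otimes> n = a m \<otimes> b n\<close>.\<close>

lemma lact_balanced_map:
  assumes "a \<in> carrier A"
  shows "balanced_map A M N (tensor_group A M N) (\<lambda>m n. pure (a \<rightharpoonup>\<^bsub>M\<^esub> m) n)"
  by unfold_locales
    (use assms in \<open>simp_all add: PG.closed PG.add_left PG.add_right PG.balanced M.lact_closed
      M.lact_add flip: M.lact_ract\<close>)

lemma ract_balanced_map:
  assumes "a \<in> carrier A"
  shows "balanced_map A M N (tensor_group A M N) (\<lambda>m n. pure m (n \<leftharpoonup>\<^bsub>N\<^esub> a))"
  by unfold_locales
    (use assms in \<open>simp_all add: PG.closed PG.add_left PG.add_right PG.balanced N.ract_closed
      N.add_ract N.lact_ract\<close>)

lemma lact_tensor: "a \<rightharpoonup>\<^bsub>T\<^esub> t = tensor_lift (tensor_group A M N) (\<lambda>m n. pure (a \<rightharpoonup>\<^bsub>M\<^esub> m) n) t"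
  by (simp add: tensor_def)

lemma ract_tensor: "t \<leftharpoonup>\<^bsub>T\<^esub> a = tensor_lift (tensor_group A M N) (\<lambda>m n. pure m (n \<leftharpoonup>\<^bsub>N\<^esub> a)) t"
  by (simp add: tensor_def)

lemma lact_pure:
  assumes "a \<in> carrier A" "m \<in> carrier M" "n \<in> carrier N"
  shows "a \<rightharpoonup>\<^bsub>T\<^esub> pure m n = pure (a \<rightharpoonup>\<^bsub>M\<^esub> m) n"
  unfolding lact_tensor using balanced_map.lift_pure[OF lact_balanced_map] assms by simp

lemma ract_pure:
  assumes "a \<in> carrier A" "m \<in> carrier M" "n \<in> carrier N"
  shows "pure m n \<leftharpoonup>\<^bsub>T\<^esub> a = pure m (n \<leftharpoonup>\<^bsub>N\<^esub> a)"
  unfolding ract_tensor using balanced_map.lift_pure[OF ract_balanced_map] assms by simp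

text \<open>In each axiom with a single tensor both sides are additive in it. On pure tensors the
  left action touches only the first factor and the right action only the second, so the axioms of
  \<open>M\<close> and \<open>N\<close> apply.\<close>

lemma bimodule_tensor: "bimodule A T"
proof -
  have lc: "a \<rightharpoonup>\<^bsub>T\<^esub> t \<in> carrier T" if "a \<in> carrier A" "t \<in> carrier T" for a t
    unfolding lact_tensor using balanced_map.lift_closed[OF lact_balanced_map] that by (simp add: tensor_simps)
  have rc: "t \<leftharpoonup>\<^bsub>T\<^esub> a \<in> carrier T" if "a \<in> carrier A" "t \<in> carrier T" for a t
    unfolding ract_tensor using balanced_map.lift_closed[OF ract_balanced_map] that by (simp add: tensor_simps)
  have la: "a \<rightharpoonup>\<^bsub>T\<^esub> (s \<oplus>\<^bsub>T\<^esub> t) = (a \<rightharpoonup>\<^bsub>T\<^esub> s) \<oplus>\<^bsub>T\<^esub> (a \<rightharpoonup>\<^bsub>T\<^esub> t)"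
    if "a \<in> carrier A" "s \<in> carrier T" "t \<in> carrier T" for a s t
    unfolding lact_tensor using balanced_map.lift_add[OF lact_balanced_map] that by (simp add: tensor_simps)
  have ra: "(s \<oplus>\<^bsub>T\<^esub> t) \<leftharpoonup>\<^bsub>T\<^esub> a = (s \<leftharpoonup>\<^bsub>T\<^esub> a) \<oplus>\<^bsub>T\<^esub> (t \<leftharpoonup>\<^bsub>T\<^esub> a)"
    if "a \<in> carrier A" "s \<in> carrier T" "t \<in> carrier T" for a s t
    unfolding ract_tensor using balanced_map.lift_add[OF ract_balanced_map] that by (simp add: tensor_simps)
  note eqI = tensor_additive_eqI[OF M.bimodule_axioms N.bimodule_axioms, where G = T]
  show ?thesis
  proof unfold_locales
    fix a b t assume *: "a \<in> carrier A" "b \<in> carrier A" "t \<in> carrier T"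
    show "(a \<oplus>\<^bsub>A\<^esub> b) \<rightharpoonup>\<^bsub>T\<^esub> t = (a \<rightharpoonup>\<^bsub>T\<^esub> t) \<oplus>\<^bsub>T\<^esub> (b \<rightharpoonup>\<^bsub>T\<^esub> t)"
      by (rule eqI[OF *(3)])
        (use * in \<open>simp_all add: la lc lact_pure M.add_lact P.add_left M.lact_closed P.G.a_ac\<close>)
    show "t \<leftharpoonup>\<^bsub>T\<^esub> (a \<oplus>\<^bsub>A\<^esub> b) = (t \<leftharpoonup>\<^bsub>T\<^esub> a) \<oplus>\<^bsub>T\<^esub> (t \<leftharpoonup>\<^bsub>T\<^esub> b)"
      by (rule eqI[OF *(3)])
        (use * in \<open>simp_all add: ra rc ract_pure N.ract_add P.add_right N.ract_closed P.G.a_ac\<close>)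
    show "(a \<otimes>\<^bsub>A\<^esub> b) \<rightharpoonup>\<^bsub>T\<^esub> t = a \<rightharpoonup>\<^bsub>T\<^esub> (b \<rightharpoonup>\<^bsub>T\<^esub> t)"
      by (rule eqI[OF *(3)])
        (use * in \<open>simp_all add: la lc lact_pure M.mult_lact M.lact_closed\<close>)
    show "t \<leftharpoonup>\<^bsub>T\<^esub> (a \<otimes>\<^bsub>A\<^esub> b) = (t \<leftharpoonup>\<^bsub>T\<^esub> a) \<leftharpoonup>\<^bsub>T\<^esub> b"
      by (rule eqI[OF *(3)])
        (use * in \<open>simp_all add: ra rc ract_pure N.ract_mult N.ract_closed\<close>)
    show "(a \<rightharpoonup>\<^bsub>T\<^esub> t) \<leftharpoonup>\<^bsub>T\<^esub> b = a \<rightharpoonup>\<^bsub>T\<^esub> (t \<leftharpoonup>\<^bsub>T\<^esub> b)"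
      by (rule eqI[OF *(3)])
        (use * in \<open>simp_all add: la ra lc rc lact_pure ract_pure M.lact_closed N.ract_closed\<close>)
  qed (use lc rc la ra in auto)
qed

end

context balanced_map
begin

sublocale two: two_bimodules A M N ..

lemma lift_eqI:
  assumes "t \<in> carrier (tensor A M N)"
    and "\<And>s t. \<lbrakk>s \<in> carrier (tensor A M N); t \<in> carrier (tensor A M N)\<rbrakk>
      \<Longrightarrow> \<Phi> (s \<oplus>\<^bsub>tensor A M N\<^esub> t) = \<Phi> s \<oplus>\<^bsub>G\<^esub> \<Phi> t"
    and "\<And>m n. \<lbrakk>m \<in> carrier M; n \<in> carrier N\<rbrakk> \<Longrightarrow> \<Phi> (pure_tensor A M N m n) = f m n"
  shows "\<Phi> t = tensor_lift G f t"
  by (rule tensor_additive_eqI[OF M.bimodule_axioms N.bimodule_axioms assms(1), where G = G])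
    (simp_all only: assms lift_add lift_pure)

end

section \<open>Bimodule maps out of a tensor product and functoriality\<close>

lemma bimodule_homD:
  assumes "f \<in> bimodule_hom A M N"
  shows "m \<in> carrier M \<Longrightarrow> f m \<in> carrier N"
    and "\<lbrakk>m \<in> carrier M; m' \<in> carrier M\<rbrakk> \<Longrightarrow> f (m \<oplus>\<^bsub>M\<^esub> m') = f m \<oplus>\<^bsub>N\<^esub> f m'"
    and "\<lbrakk>a \<in> carrier A; m \<in> carrier M\<rbrakk> \<Longrightarrow> f (a \<rightharpoonup>\<^bsub>M\<^esub> m) = a \<rightharpoonup>\<^bsub>N\<^esub> f m"
    and "\<lbrakk>a \<in> carrier A; m \<in> carrier M\<rbrakk> \<Longrightarrow> f (m \<leftharpoonup>\<^bsub>M\<^esub> a) = f m \<leftharpoonup>\<^bsub>N\<^esub> a"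
  using assms by (auto simp: bimodule_hom_def)


lemma lift_bimodule_hom:
  assumes "balanced_map A M N G f" "bimodule A G"
    and l: "\<And>a m n. \<lbrakk>a \<in> carrier A; m \<in> carrier M; n \<in> carrier N\<rbrakk> \<Longrightarrow> f (a \<rightharpoonup>\<^bsub>M\<^esub> m) n = a \<rightharpoonup>\<^bsub>G\<^esub> f m n"
    and r: "\<And>a m n. \<lbrakk>a \<in> carrier A; m \<in> carrier M; n \<in> carrier N\<rbrakk> \<Longrightarrow> f m (n \<leftharpoonup>\<^bsub>N\<^esub> a) = f m n \<leftharpoonup>\<^bsub>G\<^esub> a"
  shows "tensor_lift G f \<in> bimodule_hom A (tensor A M N) G"
proof -
  interpret balanced_map A M N G f by fact
  interpret G: bimodule A G by fact
  interpret T: bimodule A "tensor A M N" by (rule two.bimodule_tensor)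
  note eqI = tensor_additive_eqI[OF M.bimodule_axioms N.bimodule_axioms, where G = G]
  show ?thesis
    unfolding bimodule_hom_def
  proof (intro CollectI conjI ballI)
    fix a t assume *: "a \<in> carrier A" "t \<in> carrier (tensor A M N)"
    show "tensor_lift G f (a \<rightharpoonup>\<^bsub>tensor A M N\<^esub> t) = a \<rightharpoonup>\<^bsub>G\<^esub> tensor_lift G f t"
      by (rule eqI[OF *(2)])
        (use * in \<open>simp_all add: lift_add T.lact_add T.lact_closed G.lact_add lift_closed
          two.lact_pure lift_pure l M.lact_closed\<close>)
    show "tensor_lift G f (t \<leftharpoonup>\<^bsub>tensor A M N\<^esub> a) = tensor_lift G f t \<leftharpoonup>\<^bsub>G\<^esub> a"
      by (rule eqI[OF *(2)])
        (use * in \<open>simp_all add: lift_add T.add_ract T.ract_closed G.add_ract lift_closed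
          two.ract_pure lift_pure r N.ract_closed\<close>)
  qed (use lift_closed lift_add in auto)
qed

lemma tensor_map_balanced_map:
  assumes "bimodule A M" "bimodule A N" "bimodule A M'" "bimodule A N'"
    and "u \<in> bimodule_hom A M M'" "v \<in> bimodule_hom A N N'"
  shows "balanced_map A M N (tensor A M' N') (\<lambda>m n. pure_tensor A M' N' (u m) (v n))"
proof -
  interpret MN: two_bimodules A M N by (rule two_bimodules.intro) fact+
  interpret MN': two_bimodules A M' N' by (rule two_bimodules.intro) fact+
  note u = bimodule_homD[OF assms(5)] and v = bimodule_homD[OF assms(6)]
  show ?thesis
    by unfold_locales
      (simp_all add: u v MN'.P.closed MN'.P.add_left MN'.P.add_right MN'.P.balanced)
qed

lemma tensor_map_pure:
  assumes "bimodule A M" "bimodule A N" "bimodule A M'" "bimodule A N'"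
    and "u \<in> bimodule_hom A M M'" "v \<in> bimodule_hom A N N'" "m \<in> carrier M" "n \<in> carrier N"
  shows "tensor_map A M' N' u v (pure_tensor A M N m n) = pure_tensor A M' N' (u m) (v n)"
  unfolding tensor_map_def
  by (rule balanced_map.lift_pure[OF tensor_map_balanced_map]) fact+

lemma tensor_map_hom:
  assumes "bimodule A M" "bimodule A N" "bimodule A M'" "bimodule A N'"
    and "u \<in> bimodule_hom A M M'" "v \<in> bimodule_hom A N N'"
  shows "tensor_map A M' N' u v \<in> bimodule_hom A (tensor A M N) (tensor A M' N')"
proof -
  interpret MN: two_bimodules A M' N' by (rule two_bimodules.intro) fact+
  note u = bimodule_homD[OF assms(5)] and v = bimodule_homD[OF assms(6)]
  show ?thesis
    unfolding tensor_map_def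
    by (rule lift_bimodule_hom[OF tensor_map_balanced_map[OF assms] MN.bimodule_tensor])
      (simp_all only: u v MN.lact_pure MN.ract_pure)
qed

section \<open>Unital parts\<close>

lemma bimodule_sub:
  assumes "bimodule A M" "N = M\<lparr>carrier := X\<rparr>" "X \<subseteq> carrier M" "X \<noteq> {}"
    and add: "\<And>m n. \<lbrakk>m \<in> X; n \<in> X\<rbrakk> \<Longrightarrow> m \<oplus>\<^bsub>M\<^esub> n \<in> X"
    and l: "\<And>a m. \<lbrakk>a \<in> carrier A; m \<in> X\<rbrakk> \<Longrightarrow> a \<rightharpoonup>\<^bsub>M\<^esub> m \<in> X"
    and r: "\<And>a m. \<lbrakk>a \<in> carrier A; m \<in> X\<rbrakk> \<Longrightarrow> m \<leftharpoonup>\<^bsub>M\<^esub> a \<in> X"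
    and neg: "\<And>m. m \<in> X \<Longrightarrow> \<ominus>\<^bsub>M\<^esub> m \<in> X"
  shows "bimodule A N"
proof -
  interpret M: bimodule A M by fact
  note [simp] = \<open>N = _\<close>
  note X = subsetD[OF assms(3)]
  have zero: "\<zero>\<^bsub>M\<^esub> \<in> X"
    using assms(4) add neg X M.M.r_neg by (metis ex_in_conv)
  have ex: "\<exists>n\<in>X. n \<oplus>\<^bsub>M\<^esub> m = \<zero>\<^bsub>M\<^esub>" if "m \<in> X" for m
    using that neg X M.M.l_neg by blast
  interpret N: abelian_group N
    by (rule abelian_groupI) (use X zero add ex in \<open>simp_all add: M.M.a_ac\<close>)
  show ?thesis
    by unfold_locales
      (simp_all add: X l r M.lact_add M.add_lact M.ract_add M.add_ract M.mult_lact M.ract_mult M.lact_ract)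
qed

lemma (in bimodule) lact_uminus:
  assumes "a \<in> carrier A" "m \<in> carrier M"
  shows "a \<rightharpoonup>\<^bsub>M\<^esub> (\<ominus>\<^bsub>M\<^esub> m) = \<ominus>\<^bsub>M\<^esub> (a \<rightharpoonup>\<^bsub>M\<^esub> m)"
proof -
  have z: "a \<rightharpoonup>\<^bsub>M\<^esub> \<zero>\<^bsub>M\<^esub> = \<zero>\<^bsub>M\<^esub>"
    using lact_add[of a "\<zero>\<^bsub>M\<^esub>" "\<zero>\<^bsub>M\<^esub>"] lact_closed[of a "\<zero>\<^bsub>M\<^esub>"] assms by simp
  show ?thesis
    using lact_add[of a "\<ominus>\<^bsub>M\<^esub> m" m] assms
    by (simp add: M.l_neg z M.minus_equality lact_closed)
qed

lemma (in bimodule) ract_uminus: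
  assumes "a \<in> carrier A" "m \<in> carrier M"
  shows "(\<ominus>\<^bsub>M\<^esub> m) \<leftharpoonup>\<^bsub>M\<^esub> a = \<ominus>\<^bsub>M\<^esub> (m \<leftharpoonup>\<^bsub>M\<^esub> a)"
proof -
  have z: "\<zero>\<^bsub>M\<^esub> \<leftharpoonup>\<^bsub>M\<^esub> a = \<zero>\<^bsub>M\<^esub>"
    using add_ract[of a "\<zero>\<^bsub>M\<^esub>" "\<zero>\<^bsub>M\<^esub>"] ract_closed[of a "\<zero>\<^bsub>M\<^esub>"] assms by simp
  show ?thesis
    using add_ract[of a "\<ominus>\<^bsub>M\<^esub> m" m] assms
    by (simp add: M.l_neg z M.minus_equality ract_closed)
qed

context bimodule
begin

text \<open>Acting by \<open>\<one>\<close> is idempotent, so its image is the set of its fixed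
  points. In this form the closure properties become equations.\<close>

lemma mem_right_unital_part:
  "m \<in> carrier (right_unital_part A M) \<longleftrightarrow> m \<in> carrier M \<and> m \<leftharpoonup>\<^bsub>M\<^esub> \<one>\<^bsub>A\<^esub> = m"
  by (force simp: right_unital_part_def ract_closed simp flip: ract_mult)

lemma mem_left_unital_part:
  "m \<in> carrier (left_unital_part A M) \<longleftrightarrow> m \<in> carrier M \<and> \<one>\<^bsub>A\<^esub> \<rightharpoonup>\<^bsub>M\<^esub> m = m"
  by (force simp: left_unital_part_def lact_closed simp flip: mult_lact)

lemma bimodule_right_unital_part: "bimodule A (right_unital_part A M)"
proof (rule bimodule_sub[OF bimodule_axioms])
  show "right_unital_part A M = M\<lparr>carrier := carrier (right_unital_part A M)\<rparr>"
    by (simp add: right_unital_part_def)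
  show "carrier (right_unital_part A M) \<noteq> {}"
    using M.zero_closed by (auto simp: right_unital_part_def)
qed (auto simp: mem_right_unital_part add_ract lact_ract lact_closed ract_closed ract_uminus
    simp flip: ract_mult)

lemma bimodule_left_unital_part: "bimodule A (left_unital_part A M)"
proof (rule bimodule_sub[OF bimodule_axioms])
  show "left_unital_part A M = M\<lparr>carrier := carrier (left_unital_part A M)\<rparr>"
    by (simp add: left_unital_part_def)
  show "carrier (left_unital_part A M) \<noteq> {}"
    using M.zero_closed by (auto simp: left_unital_part_def)
qed (auto simp: mem_left_unital_part lact_add lact_closed ract_closed lact_uminus
    simp flip: mult_lact lact_ract)

end

lemma right_unital_part_simps [simp]:
  "add (right_unital_part A M) = add M" "\<zero>\<^bsub>right_unital_part A M\<^esub> = \<zero>\<^bsub>M\<^esub>"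
  "lact (right_unital_part A M) = lact M" "ract (right_unital_part A M) = ract M"
  by (simp_all add: right_unital_part_def)

lemma left_unital_part_simps [simp]:
  "add (left_unital_part A M) = add M" "\<zero>\<^bsub>left_unital_part A M\<^esub> = \<zero>\<^bsub>M\<^esub>"
  "lact (left_unital_part A M) = lact M" "ract (left_unital_part A M) = ract M"
  by (simp_all add: left_unital_part_def)

lemma regular_bimodule_simps [simp]:
  "carrier (regular_bimodule A) = carrier A"
  "add (regular_bimodule A) = add A" "\<zero>\<^bsub>regular_bimodule A\<^esub> = \<zero>\<^bsub>A\<^esub>"
  "lact (regular_bimodule A) = monoid.mult A" "ract (regular_bimodule A) = monoid.mult A"
  by (simp_all add: regular_bimodule_def)

section \<open>The left dual as a bimodule\<close>

lemma left_dual_simps: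
  "\<zero>\<^bsub>left_dual A C\<^esub> = (\<lambda>c\<in>carrier C. \<zero>\<^bsub>A\<^esub>)"
  "f \<oplus>\<^bsub>left_dual A C\<^esub> g = (\<lambda>c\<in>carrier C. f c \<oplus>\<^bsub>A\<^esub> g c)"
  "a \<rightharpoonup>\<^bsub>left_dual A C\<^esub> f = (\<lambda>c\<in>carrier C. f (c \<leftharpoonup>\<^bsub>C\<^esub> a))"
  "f \<leftharpoonup>\<^bsub>left_dual A C\<^esub> b = (\<lambda>c\<in>carrier C. f c \<otimes>\<^bsub>A\<^esub> b)"
  by (simp_all add: left_dual_def)

lemma left_dualD:
  assumes "f \<in> carrier (left_dual A C)"
  shows "c \<in> carrier C \<Longrightarrow> f c \<in> carrier A"
    and "\<lbrakk>c \<in> carrier C; d \<in> carrier C\<rbrakk> \<Longrightarrow> f (c \<oplus>\<^bsub>C\<^esub> d) = f c \<oplus>\<^bsub>A\<^esub> f d"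
    and "\<lbrakk>a \<in> carrier A; c \<in> carrier C\<rbrakk> \<Longrightarrow> f (a \<rightharpoonup>\<^bsub>C\<^esub> c) = a \<otimes>\<^bsub>A\<^esub> f c"
    and "f \<in> extensional (carrier C)"
  using assms by (auto simp: left_dual_def PiE_def)

lemma left_dualI:
  assumes "f \<in> extensional (carrier C)"
    and "\<And>c. c \<in> carrier C \<Longrightarrow> f c \<in> carrier A"
    and "\<And>c d. \<lbrakk>c \<in> carrier C; d \<in> carrier C\<rbrakk> \<Longrightarrow> f (c \<oplus>\<^bsub>C\<^esub> d) = f c \<oplus>\<^bsub>A\<^esub> f d"
    and "\<And>a c. \<lbrakk>a \<in> carrier A; c \<in> carrier C\<rbrakk> \<Longrightarrow> f (a \<rightharpoonup>\<^bsub>C\<^esub> c) = a \<otimes>\<^bsub>A\<^esub> f c"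
  shows "f \<in> carrier (left_dual A C)"
  using assms by (auto simp: left_dual_def PiE_def)

lemma left_dual_eqI:
  assumes "f \<in> carrier (left_dual A C)" "g \<in> carrier (left_dual A C)"
    and "\<And>c. c \<in> carrier C \<Longrightarrow> f c = g c"
  shows "f = g"
  using assms by (meson extensionalityI left_dualD(4))

text \<open>The left action on functionals comes from the right action on \<open>C\<close> and keeps
  the order of factors: \<open>((a b) f)(c) = f ((c a) b) = (a (b f))(c)\<close>.\<close>

lemma bimodule_left_dual:
  assumes "bimodule A C"
  shows "bimodule A (left_dual A C)"
proof -
  interpret C: bimodule A C by fact
  let ?D = "left_dual A C"
  note [simp] = C.lact_closed C.ract_closed C.lact_add C.add_lact C.ract_add C.add_ract
    C.mult_lact C.ract_mult C.lact_ract left_dualD(1-3)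
  have zero: "\<zero>\<^bsub>?D\<^esub> \<in> carrier ?D"
    by (rule left_dualI) (auto simp: left_dual_simps)
  have add: "f \<oplus>\<^bsub>?D\<^esub> g \<in> carrier ?D" if "f \<in> carrier ?D" "g \<in> carrier ?D" for f g
    by (rule left_dualI) (use that in \<open>auto simp: left_dual_simps C.A.r_distr C.A.a_ac\<close>)
  have lact: "a \<rightharpoonup>\<^bsub>?D\<^esub> f \<in> carrier ?D" if "f \<in> carrier ?D" "a \<in> carrier A" for f a
    by (rule left_dualI) (use that in \<open>auto simp: left_dual_simps\<close>)
  have ract: "f \<leftharpoonup>\<^bsub>?D\<^esub> a \<in> carrier ?D" if "f \<in> carrier ?D" "a \<in> carrier A" for f a
    by (rule left_dualI) (use that in \<open>auto simp: left_dual_simps C.A.l_distr C.A.m_assoc\<close>)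
  have neg: "(\<lambda>c\<in>carrier C. \<ominus>\<^bsub>A\<^esub> f c) \<in> carrier ?D" if "f \<in> carrier ?D" for f
    by (rule left_dualI) (use that in \<open>auto simp: C.A.minus_add C.A.r_minus\<close>)
  interpret D: abelian_group ?D
  proof (rule abelian_groupI)
    fix f assume f: "f \<in> carrier ?D"
    show "\<exists>g\<in>carrier ?D. g \<oplus>\<^bsub>?D\<^esub> f = \<zero>\<^bsub>?D\<^esub>"
      by (rule bexI[OF _ neg[OF f]])
        (rule left_dual_eqI[OF add[OF neg[OF f] f] zero], use f in \<open>simp add: left_dual_simps C.A.l_neg\<close>)
  next
    fix f assume f: "f \<in> carrier ?D"
    show "\<zero>\<^bsub>?D\<^esub> \<oplus>\<^bsub>?D\<^esub> f = f"
      by (rule left_dual_eqI[OF add[OF zero f] f]) (use f in \<open>simp add: left_dual_simps\<close>)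
  next
    fix f g h assume *: "f \<in> carrier ?D" "g \<in> carrier ?D" "h \<in> carrier ?D"
    show "f \<oplus>\<^bsub>?D\<^esub> g \<oplus>\<^bsub>?D\<^esub> h = f \<oplus>\<^bsub>?D\<^esub> (g \<oplus>\<^bsub>?D\<^esub> h)"
      by (intro left_dual_eqI[where A = A and C = C] add *) (use * in \<open>simp_all add: left_dual_simps C.A.a_assoc\<close>)
  next
    fix f g assume *: "f \<in> carrier ?D" "g \<in> carrier ?D"
    show "f \<oplus>\<^bsub>?D\<^esub> g = g \<oplus>\<^bsub>?D\<^esub> f"
      by (intro left_dual_eqI[where A = A and C = C] add *) (use * in \<open>simp_all add: left_dual_simps C.A.a_comm\<close>)
  qed (use zero add in auto)
  note eqI = left_dual_eqI[where A = A and C = C]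
  show ?thesis
  proof unfold_locales
    fix a f g assume *: "a \<in> carrier A" "f \<in> carrier ?D" "g \<in> carrier ?D"
    show "a \<rightharpoonup>\<^bsub>?D\<^esub> (f \<oplus>\<^bsub>?D\<^esub> g) = (a \<rightharpoonup>\<^bsub>?D\<^esub> f) \<oplus>\<^bsub>?D\<^esub> (a \<rightharpoonup>\<^bsub>?D\<^esub> g)"
      by (intro eqI add lact *) (use * in \<open>simp_all add: left_dual_simps\<close>)
    show "(f \<oplus>\<^bsub>?D\<^esub> g) \<leftharpoonup>\<^bsub>?D\<^esub> a = (f \<leftharpoonup>\<^bsub>?D\<^esub> a) \<oplus>\<^bsub>?D\<^esub> (g \<leftharpoonup>\<^bsub>?D\<^esub> a)"
      by (intro eqI add ract *) (use * in \<open>simp_all add: left_dual_simps C.A.l_distr\<close>)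
  next
    fix a b f assume *: "a \<in> carrier A" "b \<in> carrier A" "f \<in> carrier ?D"
    show "(a \<oplus>\<^bsub>A\<^esub> b) \<rightharpoonup>\<^bsub>?D\<^esub> f = (a \<rightharpoonup>\<^bsub>?D\<^esub> f) \<oplus>\<^bsub>?D\<^esub> (b \<rightharpoonup>\<^bsub>?D\<^esub> f)"
      by (intro eqI add lact * C.A.a_closed) (use * in \<open>simp_all add: left_dual_simps\<close>)
    show "f \<leftharpoonup>\<^bsub>?D\<^esub> (a \<oplus>\<^bsub>A\<^esub> b) = (f \<leftharpoonup>\<^bsub>?D\<^esub> a) \<oplus>\<^bsub>?D\<^esub> (f \<leftharpoonup>\<^bsub>?D\<^esub> b)"
      by (intro eqI add ract * C.A.a_closed) (use * in \<open>simp_all add: left_dual_simps C.A.r_distr\<close>)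
    show "(a \<otimes>\<^bsub>A\<^esub> b) \<rightharpoonup>\<^bsub>?D\<^esub> f = a \<rightharpoonup>\<^bsub>?D\<^esub> (b \<rightharpoonup>\<^bsub>?D\<^esub> f)"
      by (intro eqI lact * C.A.m_closed) (use * in \<open>simp_all add: left_dual_simps\<close>)
    show "f \<leftharpoonup>\<^bsub>?D\<^esub> (a \<otimes>\<^bsub>A\<^esub> b) = (f \<leftharpoonup>\<^bsub>?D\<^esub> a) \<leftharpoonup>\<^bsub>?D\<^esub> b"
      by (intro eqI ract * C.A.m_closed) (use * in \<open>simp_all add: left_dual_simps C.A.m_assoc\<close>)
    show "(a \<rightharpoonup>\<^bsub>?D\<^esub> f) \<leftharpoonup>\<^bsub>?D\<^esub> b = a \<rightharpoonup>\<^bsub>?D\<^esub> (f \<leftharpoonup>\<^bsub>?D\<^esub> b)"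
      by (intro eqI lact ract *) (use * in \<open>simp_all add: left_dual_simps\<close>)
  qed (use lact ract in auto)
qed

text \<open>The right action multiplies values in the unital ring \<open>A\<close>, whatever
  \<open>C\<close> is; the left action of \<open>\<one>\<close>, in contrast, evaluates at
  \<open>c 1\<close>.\<close>

lemma right_unital_left_dual:
  assumes "bimodule A C"
  shows "right_unital A (left_dual A C)"
proof -
  interpret C: bimodule A C by fact
  interpret D: bimodule A "left_dual A C" by (rule bimodule_left_dual) fact
  show ?thesis
    unfolding right_unital_def
    by (intro ballI left_dual_eqI[where A = A and C = C] D.ract_closed C.A.one_closed) (simp_all add: left_dual_simps left_dualD)
qed

section \<open>The convolution product\<close>

lemma left_dual_apply:
  assumes "c \<in> carrier C"
  shows "(f \<oplus>\<^bsub>left_dual A C\<^esub> g) c = f c \<oplus>\<^bsub>A\<^esub> g c"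
    and "(a \<rightharpoonup>\<^bsub>left_dual A C\<^esub> f) c = f (c \<leftharpoonup>\<^bsub>C\<^esub> a)"
    and "(f \<leftharpoonup>\<^bsub>left_dual A C\<^esub> b) c = f c \<otimes>\<^bsub>A\<^esub> b"
  using assms by (simp_all add: left_dual_simps)

text \<open>This is \<open>T f\<close> of the overview. Separating it from the outer functional
  turns statements about \<open>#\<close> into statements about maps from \<open>C\<close> to
  itself.\<close>

definition right_contraction ::
    "('a, 'c) bimodule \<Rightarrow> ('c \<Rightarrow> ('c, 'c) tensor) \<Rightarrow> ('c \<Rightarrow> 'a) \<Rightarrow> 'c \<Rightarrow> 'c" where
  "right_contraction C \<Delta> f c = tensor_lift C (\<lambda>x y. x \<leftharpoonup>\<^bsub>C\<^esub> f y) (\<Delta> c)"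

text \<open>Balancedness is left linearity of \<open>f\<close>:
  \<open>(x a) f(y) = x (a f(y)) = x f(a y)\<close>.\<close>

lemma right_contraction_balanced_map:
  assumes "bimodule A C" "f \<in> carrier (left_dual A C)"
  shows "balanced_map A C C C (\<lambda>x y. x \<leftharpoonup>\<^bsub>C\<^esub> f y)"
proof -
  interpret C: bimodule A C by fact
  show ?thesis
    by unfold_locales
      (simp_all add: C.ract_closed C.add_ract C.ract_add C.ract_mult left_dualD[OF assms(2)])
qed

lemma dual_conv_apply:
  "c \<in> carrier C \<Longrightarrow> dual_conv C \<Delta> f g c = g (right_contraction C \<Delta> f c)"
  by (simp add: dual_conv_def right_contraction_def)

context coring_data
begin

abbreviation D where "D \<equiv> left_dual A C"
abbreviation CC where "CC \<equiv> tensor A C C"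
abbreviation con where "con \<equiv> right_contraction C \<Delta>"
abbreviation conv where "conv \<equiv> dual_conv C \<Delta>"

sublocale D: bimodule A D by (rule bimodule_left_dual[OF bimodule_axioms])
sublocale two: two_bimodules A C C ..
sublocale CC: bimodule A CC by (rule two.bimodule_tensor)

lemmas comult = bimodule_homD[OF comult_hom]
lemmas counit = bimodule_homD[OF counit_hom, unfolded regular_bimodule_simps]
lemmas con_balanced = right_contraction_balanced_map[OF bimodule_axioms]
lemmas C_eqI = tensor_additive_eqI[OF bimodule_axioms bimodule_axioms, where G = C]

lemma con_closed: "\<lbrakk>f \<in> carrier D; c \<in> carrier C\<rbrakk> \<Longrightarrow> con f c \<in> carrier C"
  unfolding right_contraction_def by (intro balanced_map.lift_closed[OF con_balanced] comult)

lemma con_add: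
  assumes "f \<in> carrier D" "c \<in> carrier C" "d \<in> carrier C"
  shows "con f (c \<oplus>\<^bsub>C\<^esub> d) = con f c \<oplus>\<^bsub>C\<^esub> con f d"
  unfolding right_contraction_def
  by (simp only: comult assms balanced_map.lift_add[OF con_balanced])

text \<open>Formulated for an arbitrary tensor rather than for \<open>\<Delta> c\<close>, because
  \<open>con_con\<close> applies it to a free variable of \<open>C \<otimes> C\<close> when proving
  its threefold contraction balanced.\<close>

lemma lift_con_lact:
  assumes "f \<in> carrier D" "a \<in> carrier A" "t \<in> carrier CC"
  shows "tensor_lift C (\<lambda>x y. x \<leftharpoonup>\<^bsub>C\<^esub> f y) (a \<rightharpoonup>\<^bsub>CC\<^esub> t) = a \<rightharpoonup>\<^bsub>C\<^esub> tensor_lift C (\<lambda>x y. x \<leftharpoonup>\<^bsub>C\<^esub> f y) t"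
proof -
  interpret b: balanced_map A C C C "\<lambda>x y. x \<leftharpoonup>\<^bsub>C\<^esub> f y" by (rule con_balanced) fact
  show ?thesis
    by (rule C_eqI[OF assms(3)])
      (use assms in \<open>simp_all add: b.lift_add b.lift_closed CC.lact_add CC.lact_closed lact_add
        two.lact_pure b.lift_pure lact_closed left_dualD lact_ract\<close>)
qed

lemma con_lact:
  assumes "f \<in> carrier D" "a \<in> carrier A" "c \<in> carrier C"
  shows "con f (a \<rightharpoonup>\<^bsub>C\<^esub> c) = a \<rightharpoonup>\<^bsub>C\<^esub> con f c"
  unfolding right_contraction_def by (simp only: comult assms lift_con_lact)

text \<open>The tool for computing a contraction by a composite functional: an additive
  \<open>\<Phi>\<close> that agrees with it on pure tensors may be evaluated at
  \<open>\<Delta> c\<close> instead.\<close>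

lemma con_cong_pure:
  assumes "c \<in> carrier C"
    and "\<And>s t. \<lbrakk>s \<in> carrier CC; t \<in> carrier CC\<rbrakk> \<Longrightarrow> \<Phi> (s \<oplus>\<^bsub>CC\<^esub> t) = \<Phi> s \<oplus>\<^bsub>C\<^esub> \<Phi> t"
    and "f \<in> carrier D"
    and "\<And>x y. \<lbrakk>x \<in> carrier C; y \<in> carrier C\<rbrakk> \<Longrightarrow> \<Phi> (pure_tensor A C C x y) = x \<leftharpoonup>\<^bsub>C\<^esub> f y"
  shows "con f c = \<Phi> (\<Delta> c)"
  unfolding right_contraction_def
  by (rule balanced_map.lift_eqI[OF con_balanced, symmetric]) (fact assms comult(1)[OF assms(1)])+

lemma con_dual_add:
  assumes "f \<in> carrier D" "g \<in> carrier D" "c \<in> carrier C"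
  shows "con (f \<oplus>\<^bsub>D\<^esub> g) c = con f c \<oplus>\<^bsub>C\<^esub> con g c"
proof -
  interpret f: balanced_map A C C C "\<lambda>x y. x \<leftharpoonup>\<^bsub>C\<^esub> f y" by (rule con_balanced) fact
  interpret g: balanced_map A C C C "\<lambda>x y. x \<leftharpoonup>\<^bsub>C\<^esub> g y" by (rule con_balanced) fact
  show ?thesis
    unfolding right_contraction_def[of C \<Delta> f] right_contraction_def[of C \<Delta> g]
    by (rule con_cong_pure)
      (use assms in \<open>simp_all add: D.M.a_closed f.lift_add g.lift_add f.lift_closed g.lift_closed
        f.lift_pure g.lift_pure M.a_ac left_dual_apply ract_add left_dualD\<close>)
qed

lemma con_dual_ract:
  assumes "f \<in> carrier D" "b \<in> carrier A" "c \<in> carrier C"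
  shows "con (f \<leftharpoonup>\<^bsub>D\<^esub> b) c = con f c \<leftharpoonup>\<^bsub>C\<^esub> b"
proof -
  interpret f: balanced_map A C C C "\<lambda>x y. x \<leftharpoonup>\<^bsub>C\<^esub> f y" by (rule con_balanced) fact
  show ?thesis
    unfolding right_contraction_def[of C \<Delta> f]
    by (rule con_cong_pure)
      (use assms in \<open>simp_all add: D.ract_closed f.lift_add f.lift_closed
        f.lift_pure left_dual_apply add_ract ract_mult left_dualD\<close>)
qed

text \<open>Right linearity of \<open>\<Delta>\<close> enters here: \<open>x f(y a)\<close> is the
  contraction of \<open>(x \<otimes> y) a\<close>, and
  \<open>(\<Delta> c) a = \<Delta> (c a)\<close>. With \<open>a = \<one>\<close> it moves the unit
  between functional and argument in the unit laws.\<close>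

lemma con_dual_lact:
  assumes "f \<in> carrier D" "a \<in> carrier A" "c \<in> carrier C"
  shows "con (a \<rightharpoonup>\<^bsub>D\<^esub> f) c = con f (c \<leftharpoonup>\<^bsub>C\<^esub> a)"
proof -
  interpret f: balanced_map A C C C "\<lambda>x y. x \<leftharpoonup>\<^bsub>C\<^esub> f y" by (rule con_balanced) fact
  show ?thesis
    unfolding right_contraction_def[of C \<Delta> f] comult(4)[OF assms(2,3)]
    by (rule con_cong_pure)
      (use assms in \<open>simp_all add: D.lact_closed CC.add_ract CC.ract_closed f.lift_add two.ract_pure
        f.lift_pure left_dual_apply ract_closed\<close>)
qed

lemma conv_closed:
  assumes "f \<in> carrier D" "g \<in> carrier D"
  shows "conv f g \<in> carrier D"
  by (rule left_dualI)
    (use assms in \<open>simp_all add: dual_conv_apply con_closed con_add con_lact left_dualD lact_closed\<close>,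
     simp add: dual_conv_def)

text \<open>For the middle action, both sides at \<open>c\<close> are
  \<open>g ((con f c) a)\<close>; additivity in \<open>f\<close> is that of the contraction,
  additivity in \<open>g\<close> is pointwise.\<close>

lemma conv_balanced_map: "balanced_map A D D D conv"
proof -
  note eqI = left_dual_eqI[where A = A and C = C]
  note [simp] = dual_conv_apply con_closed left_dualD(1-3) left_dual_apply ract_closed lact_closed
  show ?thesis
  proof unfold_locales
    fix f g assume "f \<in> carrier D" "g \<in> carrier D"
    then show "conv f g \<in> carrier D" by (rule conv_closed)
  next
    fix f g h assume *: "f \<in> carrier D" "g \<in> carrier D" "h \<in> carrier D"
    show "conv (f \<oplus>\<^bsub>D\<^esub> g) h = conv f h \<oplus>\<^bsub>D\<^esub> conv g h"
      by (intro eqI conv_closed D.M.a_closed *) (use * in \<open>simp add: con_dual_add\<close>)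
    show "conv f (g \<oplus>\<^bsub>D\<^esub> h) = conv f g \<oplus>\<^bsub>D\<^esub> conv f h"
      by (intro eqI conv_closed D.M.a_closed *) (use * in simp)
  next
    fix f a g assume *: "f \<in> carrier D" "a \<in> carrier A" "g \<in> carrier D"
    show "conv (f \<leftharpoonup>\<^bsub>D\<^esub> a) g = conv f (a \<rightharpoonup>\<^bsub>D\<^esub> g)"
      by (intro eqI conv_closed D.ract_closed D.lact_closed *)
        (use * in \<open>simp add: con_dual_ract\<close>)
  qed
qed

lemma mult_pure:
  "\<lbrakk>f \<in> carrier D; g \<in> carrier D\<rbrakk> \<Longrightarrow> dual_mult A C \<Delta> (pure_tensor A D D f g) = conv f g"
  unfolding dual_mult_def by (rule balanced_map.lift_pure[OF conv_balanced_map])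

lemma mult_hom: "dual_mult A C \<Delta> \<in> bimodule_hom A (tensor A D D) D"
  unfolding dual_mult_def
proof (rule lift_bimodule_hom[OF conv_balanced_map D.bimodule_axioms])
  note eqI = left_dual_eqI[where A = A and C = C]
  note [simp] = dual_conv_apply con_closed left_dualD(1-3) left_dual_apply ract_closed lact_closed
  fix a f g assume *: "a \<in> carrier A" "f \<in> carrier D" "g \<in> carrier D"
  show "conv (a \<rightharpoonup>\<^bsub>D\<^esub> f) g = a \<rightharpoonup>\<^bsub>D\<^esub> conv f g"
    by (intro eqI conv_closed D.lact_closed *)
      (use * in \<open>simp add: con_dual_lact\<close>)
  show "conv f (g \<leftharpoonup>\<^bsub>D\<^esub> a) = conv f g \<leftharpoonup>\<^bsub>D\<^esub> a"
    by (intro eqI conv_closed D.ract_closed *) (use * in simp)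
qed

lemma comult_balanced_map: "balanced_map A C C (tensor A CC C) (\<lambda>w z. pure_tensor A CC C (\<Delta> w) z)"
  using tensor_map_balanced_map[OF bimodule_axioms bimodule_axioms CC.bimodule_axioms bimodule_axioms comult_hom, of id]
  by (simp add: bimodule_hom_def)

text \<open>Both sides of coassociativity are evaluated under \<open>x \<otimes> (y \<otimes> z) \<mapsto> x g(y f(z))\<close>.\<close>

lemma con_con:
  assumes f: "f \<in> carrier D" and g: "g \<in> carrier D" and c: "c \<in> carrier C"
  shows "con g (con f c) = con (conv f g) c"
proof -
  interpret f: balanced_map A C C C "\<lambda>x y. x \<leftharpoonup>\<^bsub>C\<^esub> f y" by (rule con_balanced) fact
  interpret g: balanced_map A C C C "\<lambda>x y. x \<leftharpoonup>\<^bsub>C\<^esub> g y" by (rule con_balanced) fact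
  let ?f = "tensor_lift C (\<lambda>x y. x \<leftharpoonup>\<^bsub>C\<^esub> f y)" and ?g = "tensor_lift C (\<lambda>x y. x \<leftharpoonup>\<^bsub>C\<^esub> g y)"
  let ?h = "\<lambda>x t. x \<leftharpoonup>\<^bsub>C\<^esub> g (?f t)"
  let ?\<Psi> = "tensor_lift C ?h"
  note dual = left_dualD(1-3)[OF f] left_dualD(1-3)[OF g]
  interpret h: balanced_map A C CC C ?h
    by unfold_locales
      (simp_all add: f.lift_closed f.lift_add lift_con_lact f dual ract_closed add_ract ract_add ract_mult)
  interpret l: two_bimodules A CC C ..
  have id_hom: "id \<in> bimodule_hom A C C" by (auto simp: bimodule_hom_def)
  interpret dl: balanced_map A C C "tensor A CC C" "\<lambda>w z. pure_tensor A CC C (\<Delta> w) z"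
    by (rule comult_balanced_map)
  \<comment> \<open>The associator is a lift of a lift: \<open>inner\<close> justifies the lift over
    the first two factors for a fixed third one, and \<open>k_add\<close> and \<open>k_bal\<close>
    then make the outer integrand balanced.\<close>
  have inner: "balanced_map A C C (tensor A C CC) (\<lambda>m n. pure_tensor A C CC m (pure_tensor A C C n p))"
    if "p \<in> carrier C" for p
    by unfold_locales
      (use that in \<open>simp_all add: h.two.P.closed two.P.closed h.two.P.add_left h.two.P.add_right two.P.add_left
         h.two.P.balanced two.lact_pure\<close>)
  let ?k = "\<lambda>t p. tensor_lift (tensor A C CC) (\<lambda>m n. pure_tensor A C CC m (pure_tensor A C C n p)) t"
  have k_add: "?k s (p \<oplus>\<^bsub>C\<^esub> q) = ?k s p \<oplus>\<^bsub>tensor A C CC\<^esub> ?k s q"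
    if "s \<in> carrier CC" "p \<in> carrier C" "q \<in> carrier C" for s p q
    by (rule tensor_additive_eqI[OF bimodule_axioms bimodule_axioms that(1), where G = "tensor A C CC"])
      (use that in \<open>simp_all add: balanced_map.lift_add[OF inner] balanced_map.lift_closed[OF inner]
        balanced_map.lift_pure[OF inner] h.two.P.G.a_ac two.P.add_right two.P.closed h.two.P.add_right\<close>)
  have k_bal: "?k (s \<leftharpoonup>\<^bsub>CC\<^esub> a) p = ?k s (a \<rightharpoonup>\<^bsub>C\<^esub> p)"
    if "s \<in> carrier CC" "p \<in> carrier C" "a \<in> carrier A" for s p a
    by (rule tensor_additive_eqI[OF bimodule_axioms bimodule_axioms that(1), where G = "tensor A C CC"])
      (use that in \<open>simp_all add: balanced_map.lift_add[OF inner] balanced_map.lift_closed[OF inner]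
        balanced_map.lift_pure[OF inner] lact_closed ract_closed CC.add_ract CC.ract_closed
        two.ract_pure two.P.balanced\<close>)
  interpret k: balanced_map A CC C "tensor A C CC" ?k
    by unfold_locales
      (simp_all add: balanced_map.lift_add[OF inner] balanced_map.lift_closed[OF inner] k_add k_bal)
  have assoc: "tensor_assoc A C C C = tensor_lift (tensor A C CC) ?k"
    by (simp add: tensor_assoc_def)
  \<comment> \<open>For \<open>s = x \<otimes> y\<close> both sides are
    \<open>x g(y f(z))\<close>.\<close>
  have \<Psi>_k: "?\<Psi> (?k s z) = ?g (s \<leftharpoonup>\<^bsub>CC\<^esub> f z)" if "s \<in> carrier CC" "z \<in> carrier C" for s z
    by (rule C_eqI[OF that(1)])
      (use that in \<open>simp_all add: balanced_map.lift_add[OF inner] balanced_map.lift_closed[OF inner]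
        balanced_map.lift_pure[OF inner] h.lift_add h.lift_pure two.P.closed f.lift_pure
        CC.add_ract CC.ract_closed two.ract_pure g.lift_add g.lift_pure dual ract_closed\<close>)
  \<comment> \<open>On \<open>w \<otimes> z\<close> the left side is the
    \<open>g\<close>-contraction of \<open>(\<Delta> w) f(z)\<close>, which equals
    \<open>\<Delta> (w f(z))\<close> by right linearity, hence \<open>con g (w f(z))\<close>. A
    general \<open>t\<close> permits this reduction to pure tensors.\<close>
  have left: "?\<Psi> (tensor_assoc A C C C (tensor_map A CC C \<Delta> id t)) = con g (?f t)"
    if "t \<in> carrier CC" for t
    unfolding assoc tensor_map_def right_contraction_def
    by (rule C_eqI[OF that])
      (use that in \<open>simp_all add: dl.lift_add dl.lift_closed dl.lift_pure k.lift_add k.lift_closed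
        k.lift_pure[unfolded id_apply] k.closed \<Psi>_k h.lift_add f.lift_add f.lift_closed f.lift_pure comult g.lift_add dual\<close>)
  \<comment> \<open>On \<open>x \<otimes> w\<close> this is \<open>x g(con f w)\<close>, that is,
    \<open>x\<close> times the value of \<open>conv f g\<close> at \<open>w\<close>.\<close>
  have right: "?\<Psi> (tensor_map A C CC id \<Delta> (\<Delta> c)) = con (conv f g) c"
    by (rule con_cong_pure[OF c, symmetric])
     (use f g in \<open>simp_all add: id_def conv_closed dual_conv_apply right_contraction_def
        bimodule_homD[OF tensor_map_hom[OF bimodule_axioms bimodule_axioms bimodule_axioms CC.bimodule_axioms id_hom comult_hom], unfolded id_def]
        tensor_map_pure[OF bimodule_axioms bimodule_axioms bimodule_axioms CC.bimodule_axioms id_hom comult_hom, unfolded id_def]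
       h.lift_add h.lift_pure comult\<close>)
  show ?thesis
    using left[OF comult(1)[OF c]] right coassoc[OF c] by (simp add: right_contraction_def)
qed

text \<open>Both sides at \<open>c\<close> are \<open>h (con g (con f c))\<close>.\<close>

lemma conv_assoc:
  assumes "f \<in> carrier D" "g \<in> carrier D" "h \<in> carrier D"
  shows "conv (conv f g) h = conv f (conv g h)"
  by (intro left_dual_eqI[where A = A and C = C] conv_closed assms)
    (simp add: dual_conv_apply con_con con_closed assms)

text \<open>The sides of linearity are exchanged: left linearity of \<open>\<epsilon>\<close> puts
  the values of the unit map in the dual, and right linearity of \<open>\<epsilon>\<close> makes
  that map left linear, \<open>\<epsilon> (c a) b = \<epsilon> c (a b)\<close>.\<close>

lemma unit_hom: "dual_unit A C \<epsilon> \<in> bimodule_hom A (regular_bimodule A) D"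
proof -
  have closed: "dual_unit A C \<epsilon> a \<in> carrier D" if "a \<in> carrier A" for a
    by (rule left_dualI)
      (use that in \<open>simp_all add: dual_unit_def counit A.l_distr A.m_assoc lact_closed\<close>)
  note eqI = left_dual_eqI[where A = A and C = C]
  show ?thesis
    unfolding bimodule_hom_def regular_bimodule_simps
    by (intro CollectI conjI ballI Pi_I eqI closed A.a_closed A.m_closed D.M.a_closed D.lact_closed D.ract_closed)
      (simp_all add: dual_unit_def left_dual_apply counit A.r_distr A.m_assoc ract_closed)
qed

lemma A_ring_data_dual: "A_ring_data A D (dual_mult A C \<Delta>) (dual_unit A C \<epsilon>)"
  by unfold_locales
    (simp_all add: mult_hom unit_hom mult_pure conv_closed conv_assoc)

end

section \<open>Counit laws and unit laws\<close>

context coring_data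
begin

abbreviation counit_left where "counit_left \<equiv> tensor_lift C (\<lambda>x y. \<epsilon> x \<rightharpoonup>\<^bsub>C\<^esub> y)"
abbreviation counit_right where "counit_right \<equiv> tensor_lift C (\<lambda>x y. x \<leftharpoonup>\<^bsub>C\<^esub> \<epsilon> y)"

lemma unit_closed: "a \<in> carrier A \<Longrightarrow> dual_unit A C \<epsilon> a \<in> carrier D"
  using bimodule_homD(1)[OF unit_hom] by simp

lemma counit_left_balanced_map: "balanced_map A C C C (\<lambda>x y. \<epsilon> x \<rightharpoonup>\<^bsub>C\<^esub> y)"
  by unfold_locales (simp_all add: lact_closed counit lact_add add_lact mult_lact)

lemma counit_right_balanced_map: "balanced_map A C C C (\<lambda>x y. x \<leftharpoonup>\<^bsub>C\<^esub> \<epsilon> y)"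
  by unfold_locales (simp_all add: ract_closed counit ract_add add_ract ract_mult)

lemma unit_apply: "c \<in> carrier C \<Longrightarrow> dual_unit A C \<epsilon> a c = \<epsilon> c \<otimes>\<^bsub>A\<^esub> a"
  by (simp add: dual_unit_def)

text \<open>The unit functional is extensional while \<open>\<epsilon>\<close> is arbitrary outside
  the carrier, so the two integrands are compared on pure tensors instead of being rewritten into
  each other.\<close>

lemma con_unit_eq:
  assumes "c \<in> carrier C"
  shows "con (dual_unit A C \<epsilon> \<one>\<^bsub>A\<^esub>) c = counit_right (\<Delta> c)"
  by (rule con_cong_pure[OF assms balanced_map.lift_add[OF counit_right_balanced_map]])
    (simp_all add: unit_closed balanced_map.lift_pure[OF counit_right_balanced_map] unit_apply counit)

text \<open>On \<open>x \<otimes> y\<close> both sides are \<open>\<epsilon>(x) f(y)\<close>, by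
  right linearity of \<open>\<epsilon>\<close> and left linearity of \<open>f\<close>.\<close>

lemma counit_con:
  assumes f: "f \<in> carrier D" and c: "c \<in> carrier C"
  shows "\<epsilon> (con f c) = f (counit_left (\<Delta> c))"
proof -
  interpret l: balanced_map A C C C "\<lambda>x y. \<epsilon> x \<rightharpoonup>\<^bsub>C\<^esub> y" by (rule counit_left_balanced_map)
  interpret b: balanced_map A C C C "\<lambda>x y. x \<leftharpoonup>\<^bsub>C\<^esub> f y" by (rule con_balanced) fact
  show ?thesis
    unfolding right_contraction_def
    by (rule tensor_additive_eqI[OF bimodule_axioms bimodule_axioms comult(1)[OF c], where G = A])
      (use f in \<open>simp_all add: l.lift_add l.lift_closed l.lift_pure b.lift_add b.lift_closed
        b.lift_pure counit left_dualD\<close>)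
qed

end

text \<open>On \<open>C 1\<close> the weak right-hand side \<open>c 1\<close> is \<open>c\<close>.
  Through this inclusion the left unit law and the isomorphism reach the weak case.\<close>

lemma (in left_unital_weak_coring) lax: "left_unital_lax_coring A C \<Delta> \<epsilon>"
  by unfold_locales
    (simp_all add: mem_right_unital_part left_unital weak_counit_left weak_counit_right)

context left_unital_lax_coring
begin

text \<open>The passage from \<open>c\<close> to \<open>c 1\<close> takes place inside the
  contraction by the unit functional and imposes nothing on \<open>f\<close>; so the law covers the
  whole dual and serves the weak case too.\<close>

lemma conv_unit_left:
  assumes "f \<in> carrier D"
  shows "conv (dual_unit A C \<epsilon> \<one>\<^bsub>A\<^esub>) f = \<one>\<^bsub>A\<^esub> \<rightharpoonup>\<^bsub>D\<^esub> f"
proof (intro left_dual_eqI[where A = A and C = C] conv_closed D.lact_closed unit_closed A.one_closed assms)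
  fix c assume c: "c \<in> carrier C"
  let ?e = "dual_unit A C \<epsilon> \<one>\<^bsub>A\<^esub>"
  have c1: "c \<leftharpoonup>\<^bsub>C\<^esub> \<one>\<^bsub>A\<^esub> \<in> carrier (right_unital_part A C)"
    using c by (simp add: right_unital_part_def)
  \<comment> \<open>The unit map is left linear and \<open>\<one>\<close> is idempotent, so the unit
    functional lies in the unital part.\<close>
  have "\<one>\<^bsub>A\<^esub> \<rightharpoonup>\<^bsub>D\<^esub> ?e = ?e"
    using bimodule_homD(3)[OF unit_hom, of "\<one>\<^bsub>A\<^esub>" "\<one>\<^bsub>A\<^esub>"] by simp
  then have "con ?e c = con ?e (c \<leftharpoonup>\<^bsub>C\<^esub> \<one>\<^bsub>A\<^esub>)"
    using con_dual_lact[of ?e "\<one>\<^bsub>A\<^esub>" c] c by (simp add: unit_closed)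
  also have "\<dots> = c \<leftharpoonup>\<^bsub>C\<^esub> \<one>\<^bsub>A\<^esub>"
    using lax_counit_right[OF c1] c by (simp add: con_unit_eq ract_closed)
  finally show "conv ?e f c = (\<one>\<^bsub>A\<^esub> \<rightharpoonup>\<^bsub>D\<^esub> f) c"
    using c by (simp add: dual_conv_apply left_dual_apply)
qed

text \<open>\<open>f = 1 f\<close> is used twice: to replace \<open>c\<close> by \<open>c 1\<close>
  inside the contraction, where the lax counit law then applies, and to return from
  \<open>f (c 1)\<close> to \<open>f c\<close>.\<close>

lemma conv_unit_right:
  assumes "f \<in> carrier (left_unital_part A D)"
  shows "conv f (dual_unit A C \<epsilon> \<one>\<^bsub>A\<^esub>) = f"
proof -
  have f: "f \<in> carrier D" "\<one>\<^bsub>A\<^esub> \<rightharpoonup>\<^bsub>D\<^esub> f = f"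
    using assms by (auto simp: D.mem_left_unital_part)
  show ?thesis
  proof (intro left_dual_eqI[where A = A and C = C] conv_closed unit_closed A.one_closed f)
    fix c assume c: "c \<in> carrier C"
    let ?c = "c \<leftharpoonup>\<^bsub>C\<^esub> \<one>\<^bsub>A\<^esub>"
    have c1: "?c \<in> carrier (right_unital_part A C)"
      using c by (simp add: right_unital_part_def)
    have "conv f (dual_unit A C \<epsilon> \<one>\<^bsub>A\<^esub>) c = \<epsilon> (con f c)"
      using c f by (simp add: dual_conv_apply unit_apply con_closed counit)
    also have "\<dots> = \<epsilon> (con f ?c)"
      using con_dual_lact[of f "\<one>\<^bsub>A\<^esub>" c] c f by simp
    also have "\<dots> = f ?c"
      using counit_con[of f ?c] lax_counit_left[OF c1] c f by (simp add: ract_closed)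
    also have "\<dots> = f c"
      using left_dual_apply(2)[OF c, of A "\<one>\<^bsub>A\<^esub>" f] f by simp
    finally show "conv f (dual_unit A C \<epsilon> \<one>\<^bsub>A\<^esub>) c = f c" .
  qed
qed

lemma right_unital_lax_ring_dual:
  "right_unital_lax_ring A D (dual_mult A C \<Delta>) (dual_unit A C \<epsilon>)"
proof (rule right_unital_lax_ring.intro[OF A_ring_data_dual], unfold_locales)
  show "right_unital A D" by (rule right_unital_left_dual[OF bimodule_axioms])
  fix f assume f: "f \<in> carrier (left_unital_part A D)"
  then have "f \<in> carrier D" "\<one>\<^bsub>A\<^esub> \<rightharpoonup>\<^bsub>D\<^esub> f = f" by (auto simp: D.mem_left_unital_part)
  with f show "dual_mult A C \<Delta> (pure_tensor A D D (dual_unit A C \<epsilon> \<one>\<^bsub>A\<^esub>) f) = f"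
    and "dual_mult A C \<Delta> (pure_tensor A D D f (dual_unit A C \<epsilon> \<one>\<^bsub>A\<^esub>)) = f"
    by (simp_all add: mult_pure unit_closed conv_unit_left conv_unit_right)
qed

end

lemma (in left_unital_weak_coring) right_unital_weak_ring_dual:
  "right_unital_weak_ring A D (dual_mult A C \<Delta>) (dual_unit A C \<epsilon>)"
proof (rule right_unital_weak_ring.intro[OF A_ring_data_dual], unfold_locales)
  show "right_unital A D" by (rule right_unital_left_dual[OF bimodule_axioms])
  fix f assume f: "f \<in> carrier D"
  then show "dual_mult A C \<Delta> (pure_tensor A D D (dual_unit A C \<epsilon> \<one>\<^bsub>A\<^esub>) f) = \<one>\<^bsub>A\<^esub> \<rightharpoonup>\<^bsub>D\<^esub> f"
    by (simp add: mult_pure unit_closed left_unital_lax_coring.conv_unit_left[OF lax])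
  \<comment> \<open>The weak counit law holds at \<open>c\<close> itself, so
    \<open>\<epsilon> (con f c)\<close> is \<open>f (c 1)\<close> for every \<open>f\<close>, with
    no passage to \<open>C 1\<close>.\<close>
  have "conv f (dual_unit A C \<epsilon> \<one>\<^bsub>A\<^esub>) = \<one>\<^bsub>A\<^esub> \<rightharpoonup>\<^bsub>D\<^esub> f"
  proof (intro left_dual_eqI[where A = A and C = C] conv_closed D.lact_closed unit_closed A.one_closed f)
    fix c assume c: "c \<in> carrier C"
    have "conv f (dual_unit A C \<epsilon> \<one>\<^bsub>A\<^esub>) c = \<epsilon> (con f c)"
      using c f by (simp add: dual_conv_apply unit_apply con_closed counit)
    also have "\<dots> = (\<one>\<^bsub>A\<^esub> \<rightharpoonup>\<^bsub>D\<^esub> f) c"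
      using c f by (simp add: counit_con weak_counit_left left_dual_apply)
    finally show "conv f (dual_unit A C \<epsilon> \<one>\<^bsub>A\<^esub>) c = (\<one>\<^bsub>A\<^esub> \<rightharpoonup>\<^bsub>D\<^esub> f) c" .
  qed
  with f show "dual_mult A C \<Delta> (pure_tensor A D D f (dual_unit A C \<epsilon> \<one>\<^bsub>A\<^esub>)) = \<one>\<^bsub>A\<^esub> \<rightharpoonup>\<^bsub>D\<^esub> f"
    by (simp add: mult_pure unit_closed)
qed

section \<open>The unital part of a lax ring\<close>

context right_unital_lax_ring
begin

abbreviation U where "U \<equiv> left_unital_part A R"

sublocale U: bimodule A U by (rule bimodule_left_unital_part)
sublocale two: two_bimodules A R R ..
sublocale UU: two_bimodules A U U ..

lemma U_sub: "r \<in> carrier U \<Longrightarrow> r \<in> carrier R"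
  by (simp add: mem_left_unital_part)

lemma id_U_hom: "id \<in> bimodule_hom A U R"
  by (auto simp: bimodule_hom_def U_sub)

lemmas mu = bimodule_homD[OF mu_hom]
lemmas eta = bimodule_homD[OF eta_hom, unfolded regular_bimodule_simps]
lemmas incl_hom = tensor_map_hom[OF U.bimodule_axioms U.bimodule_axioms bimodule_axioms bimodule_axioms id_U_hom id_U_hom]
lemmas incl_pure = tensor_map_pure[OF U.bimodule_axioms U.bimodule_axioms bimodule_axioms bimodule_axioms id_U_hom id_U_hom]

lemma restricted_mult_pure:
  "\<lbrakk>r \<in> carrier U; s \<in> carrier U\<rbrakk> \<Longrightarrow> restricted_mult A R \<mu> (pure_tensor A U U r s) = \<mu> (pure_tensor A R R r s)"
  by (simp add: restricted_mult_def incl_pure)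

text \<open>Left linearity of \<open>\<mu>\<close> gives \<open>1 (r s) = (1 r) s\<close>, a
  condition on the left factor alone.\<close>

lemma mu_closed_U:
  assumes "r \<in> carrier U" "s \<in> carrier R"
  shows "\<mu> (pure_tensor A R R r s) \<in> carrier U"
proof -
  have r: "r \<in> carrier R" "\<one>\<^bsub>A\<^esub> \<rightharpoonup>\<^bsub>R\<^esub> r = r" using assms by (auto simp: mem_left_unital_part)
  have "\<one>\<^bsub>A\<^esub> \<rightharpoonup>\<^bsub>R\<^esub> \<mu> (pure_tensor A R R r s) = \<mu> (pure_tensor A R R (\<one>\<^bsub>A\<^esub> \<rightharpoonup>\<^bsub>R\<^esub> r) s)"
    using mu(3)[of "\<one>\<^bsub>A\<^esub>" "pure_tensor A R R r s"] r assms
    by (simp add: two.P.closed two.lact_pure)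
  then show ?thesis
    using r assms by (simp add: mem_left_unital_part mu two.P.closed)
qed

lemma restricted_mult_closed:
  assumes "t \<in> carrier (tensor A U U)"
  shows "restricted_mult A R \<mu> t \<in> carrier U"
proof -
  show ?thesis
    using U.bimodule_axioms U.bimodule_axioms assms
  proof (induction rule: tensor_induct)
    case (pure m n)
    then show ?case by (simp add: restricted_mult_pure mu_closed_U U_sub)
  next
    case (add s t)
    have "restricted_mult A R \<mu> (s \<oplus>\<^bsub>tensor A U U\<^esub> t) = restricted_mult A R \<mu> s \<oplus>\<^bsub>U\<^esub> restricted_mult A R \<mu> t"
      using add(1,2) bimodule_homD(1,2)[OF incl_hom] mu(2) by (simp add: restricted_mult_def)
    then show ?case using add U.M.a_closed by simp
  qed
qed

lemma A_ring_left_unital_part: "A_ring A U (restricted_mult A R \<mu>) \<eta>"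
proof unfold_locales
  show "restricted_mult A R \<mu> \<in> bimodule_hom A (tensor A U U) U"
    unfolding bimodule_hom_def
    using restricted_mult_closed bimodule_homD[OF incl_hom] mu by (simp add: restricted_mult_def)
  \<comment> \<open>Corestriction of \<open>\<eta>\<close>:
    \<open>\<eta> a = \<eta> (1 a) = 1 (\<eta> a)\<close>.\<close>
  have "\<eta> a \<in> carrier U" if "a \<in> carrier A" for a
    using eta(3)[of "\<one>\<^bsub>A\<^esub>" a] eta(1) that by (simp add: mem_left_unital_part)
  then show eta_U: "\<eta> \<in> bimodule_hom A (regular_bimodule A) U"
    using eta by (simp add: bimodule_hom_def)
  show "left_unital A U" by (simp add: left_unital_def mem_left_unital_part)
  show "right_unital A U"
    using right_unital by (simp add: right_unital_def mem_left_unital_part)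
  fix r assume r: "r \<in> carrier U"
  have "\<eta> \<one>\<^bsub>A\<^esub> \<in> carrier U" using bimodule_homD(1)[OF eta_U] by simp
  then show "restricted_mult A R \<mu> (pure_tensor A U U (\<eta> \<one>\<^bsub>A\<^esub>) r) = r"
    and "restricted_mult A R \<mu> (pure_tensor A U U r (\<eta> \<one>\<^bsub>A\<^esub>)) = r"
    using r lax_unit_left lax_unit_right by (simp_all add: restricted_mult_pure)
next
  fix r s t assume "r \<in> carrier U" "s \<in> carrier U" "t \<in> carrier U"
  then show "restricted_mult A R \<mu> (pure_tensor A U U (restricted_mult A R \<mu> (pure_tensor A U U r s)) t) =
    restricted_mult A R \<mu> (pure_tensor A U U r (restricted_mult A R \<mu> (pure_tensor A U U s t)))"
    by (simp add: restricted_mult_pure mu_closed_U U_sub mu_assoc)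
qed

end

section \<open>Transport of ring structures\<close>

text \<open>The binary function \<open>m\<close> is prescribed only on values of
  \<open>\<phi>\<close>, but these exhaust \<open>S\<close>. So balancedness of \<open>m\<close>,
  and with it the meaning of \<open>tensor_lift S m\<close>, is pulled back to \<open>R\<close>
  along with the ring laws.\<close>

lemma A_ring_transport:
  assumes "A_ring A R \<mu> \<eta>" "bimodule A S"
    and hom: "\<phi> \<in> bimodule_hom A R S" and bij: "bij_betw \<phi> (carrier R) (carrier S)"
    and mult: "\<And>r s. \<lbrakk>r \<in> carrier R; s \<in> carrier R\<rbrakk> \<Longrightarrow> m (\<phi> r) (\<phi> s) = \<phi> (\<mu> (pure_tensor A R R r s))"
    and unit: "\<And>a. a \<in> carrier A \<Longrightarrow> \<theta> a = \<phi> (\<eta> a)"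
  shows "A_rings_isomorphic A R \<mu> \<eta> S (tensor_lift S m) \<theta>"
proof -
  interpret R: A_ring A R \<mu> \<eta> by fact
  interpret S: bimodule A S by fact
  interpret RR: two_bimodules A R R ..
  note \<phi> = bimodule_homD[OF hom] and mu = bimodule_homD[OF R.mu_hom]
    and eta = bimodule_homD[OF R.eta_hom, unfolded regular_bimodule_simps]
  have ex: "\<exists>r\<in>carrier R. s = \<phi> r" if "s \<in> carrier S" for s
    using bij that by (auto simp: bij_betw_def)
  note [simp] = RR.P.closed R.lact_closed R.ract_closed
  have bal: "balanced_map A S S S m"
  proof unfold_locales
    fix s t assume "s \<in> carrier S" "t \<in> carrier S"
    then obtain x y where "x \<in> carrier R" "y \<in> carrier R" "s = \<phi> x" "t = \<phi> y" using ex by meson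
    then show "m s t \<in> carrier S" by (simp add: mult \<phi> mu)
  next
    fix s t u assume "s \<in> carrier S" "t \<in> carrier S" "u \<in> carrier S"
    then obtain x y z where *: "x \<in> carrier R" "y \<in> carrier R" "z \<in> carrier R" "s = \<phi> x" "t = \<phi> y" "u = \<phi> z"
      using ex by meson
    then show "m (s \<oplus>\<^bsub>S\<^esub> t) u = m s u \<oplus>\<^bsub>S\<^esub> m t u"
      by (simp add: mult \<phi>(1) mu RR.P.add_left flip: \<phi>(2))
    show "m s (t \<oplus>\<^bsub>S\<^esub> u) = m s t \<oplus>\<^bsub>S\<^esub> m s u"
      using * by (simp add: mult \<phi>(1) mu RR.P.add_right flip: \<phi>(2))
  next
    fix s a t assume "s \<in> carrier S" "a \<in> carrier A" "t \<in> carrier S"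
    then obtain x y where "x \<in> carrier R" "y \<in> carrier R" "s = \<phi> x" "t = \<phi> y" "a \<in> carrier A"
      using ex by meson
    then show "m (s \<leftharpoonup>\<^bsub>S\<^esub> a) t = m s (a \<rightharpoonup>\<^bsub>S\<^esub> t)"
      by (simp add: mult RR.P.balanced flip: \<phi>(3,4))
  qed
  interpret m: balanced_map A S S S m by (rule bal)
  let ?\<nu> = "tensor_lift S m"
  have \<nu>_hom: "?\<nu> \<in> bimodule_hom A (tensor A S S) S"
  proof (rule lift_bimodule_hom[OF bal \<open>bimodule A S\<close>])
    fix a s t assume "a \<in> carrier A" "s \<in> carrier S" "t \<in> carrier S"
    then obtain x y where *: "x \<in> carrier R" "y \<in> carrier R" "s = \<phi> x" "t = \<phi> y" "a \<in> carrier A"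
      using ex by meson
    then show "m (a \<rightharpoonup>\<^bsub>S\<^esub> s) t = a \<rightharpoonup>\<^bsub>S\<^esub> m s t"
      by (simp add: mult mu(1) RR.lact_pure flip: \<phi>(3) mu(3))
    show "m s (t \<leftharpoonup>\<^bsub>S\<^esub> a) = m s t \<leftharpoonup>\<^bsub>S\<^esub> a"
      using * by (simp add: mult mu(1) RR.ract_pure flip: \<phi>(4) mu(4))
  qed
  have \<theta>_hom: "\<theta> \<in> bimodule_hom A (regular_bimodule A) S"
    unfolding bimodule_hom_def regular_bimodule_simps
    by (intro CollectI conjI ballI Pi_I)
      (simp_all add: unit eta(1) \<phi>(1) flip: \<phi>(2-4) eta(2-4))
  have ring: "A_ring A S ?\<nu> \<theta>"
  proof unfold_locales
    fix r s t assume "r \<in> carrier S" "s \<in> carrier S" "t \<in> carrier S"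
    then obtain x y z where "x \<in> carrier R" "y \<in> carrier R" "z \<in> carrier R" "r = \<phi> x" "s = \<phi> y" "t = \<phi> z"
      using ex by meson
    then show "?\<nu> (pure_tensor A S S (?\<nu> (pure_tensor A S S r s)) t) =
        ?\<nu> (pure_tensor A S S r (?\<nu> (pure_tensor A S S s t)))"
      by (simp add: m.lift_pure m.closed mult \<phi>(1) mu(1) R.mu_assoc)
  next
    show "left_unital A S" "right_unital A S"
      unfolding left_unital_def right_unital_def
      using R.left_unital R.right_unital
      by (auto dest!: ex simp: left_unital_def right_unital_def simp flip: \<phi>(3,4))
  next
    fix s assume "s \<in> carrier S"
    then obtain x where "x \<in> carrier R" "s = \<phi> x" using ex by meson
    then show "?\<nu> (pure_tensor A S S (\<theta> \<one>\<^bsub>A\<^esub>) s) = s" "?\<nu> (pure_tensor A S S s (\<theta> \<one>\<^bsub>A\<^esub>)) = s"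
      by (simp_all add: m.lift_pure mult unit eta(1) \<phi>(1) R.unit_left R.unit_right)
  qed (fact \<nu>_hom \<theta>_hom)+
  have "\<phi> \<in> A_ring_iso A R \<mu> \<eta> S ?\<nu> \<theta>"
    using hom bij by (simp add: A_ring_iso_def m.lift_pure mult unit \<phi>(1))
  with ring \<open>A_ring A R \<mu> \<eta>\<close> show ?thesis
    unfolding A_rings_isomorphic_def by auto
qed

section \<open>Restriction to the unital part of a coring\<close>

context left_unital_lax_coring
begin

abbreviation C1 where "C1 \<equiv> right_unital_part A C"
abbreviation S where "S \<equiv> left_dual A C1"
abbreviation DU where "DU \<equiv> left_unital_part A D"

sublocale C1: bimodule A C1 by (rule bimodule_right_unital_part)
sublocale CC1: two_bimodules A C1 C1 ..
sublocale S: bimodule A S by (rule bimodule_left_dual[OF C1.bimodule_axioms])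
sublocale DU: bimodule A DU by (rule D.bimodule_left_unital_part)

lemma C1_sub: "c \<in> carrier C1 \<Longrightarrow> c \<in> carrier C"
  by (simp add: mem_right_unital_part)

lemma ract_one_C1: "c \<in> carrier C \<Longrightarrow> c \<leftharpoonup>\<^bsub>C\<^esub> \<one>\<^bsub>A\<^esub> \<in> carrier C1"
  by (simp add: right_unital_part_def)

lemma id_C1_hom: "id \<in> bimodule_hom A C1 C"
  by (auto simp: bimodule_hom_def C1_sub)

abbreviation incl where "incl \<equiv> tensor_map A C C id id"
lemmas incl_hom = tensor_map_hom[OF C1.bimodule_axioms C1.bimodule_axioms bimodule_axioms bimodule_axioms id_C1_hom id_C1_hom]
lemmas incl_pure = tensor_map_pure[OF C1.bimodule_axioms C1.bimodule_axioms bimodule_axioms bimodule_axioms id_C1_hom id_C1_hom]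

text \<open>\<open>x \<otimes> y 1 = x \<otimes> 1 (y 1) = x 1 \<otimes> y 1\<close> since \<open>C\<close> is left unital.\<close>

lemma ract_one_in_image:
  assumes "t \<in> carrier CC"
  shows "t \<leftharpoonup>\<^bsub>CC\<^esub> \<one>\<^bsub>A\<^esub> \<in> incl ` carrier (tensor A C1 C1)"
proof -
  show ?thesis
    using bimodule_axioms bimodule_axioms assms
  proof (induction rule: tensor_induct)
    case (pure x y)
    have "pure_tensor A C C x y \<leftharpoonup>\<^bsub>CC\<^esub> \<one>\<^bsub>A\<^esub> = pure_tensor A C C x (\<one>\<^bsub>A\<^esub> \<rightharpoonup>\<^bsub>C\<^esub> (y \<leftharpoonup>\<^bsub>C\<^esub> \<one>\<^bsub>A\<^esub>))"
      using pure left_unital by (simp add: two.ract_pure left_unital_def ract_closed)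
    also have "\<dots> = incl (pure_tensor A C1 C1 (x \<leftharpoonup>\<^bsub>C\<^esub> \<one>\<^bsub>A\<^esub>) (y \<leftharpoonup>\<^bsub>C\<^esub> \<one>\<^bsub>A\<^esub>))"
      using pure by (simp add: incl_pure ract_one_C1 two.P.balanced ract_closed)
    finally show ?case
      by (rule image_eqI) (use pure in \<open>simp add: CC1.P.closed ract_one_C1\<close>)
  next
    case (add s t)
    then obtain s' t' where "s' \<in> carrier (tensor A C1 C1)" "t' \<in> carrier (tensor A C1 C1)"
      "s \<leftharpoonup>\<^bsub>CC\<^esub> \<one>\<^bsub>A\<^esub> = incl s'" "t \<leftharpoonup>\<^bsub>CC\<^esub> \<one>\<^bsub>A\<^esub> = incl t'" by blast
    then have "(s \<oplus>\<^bsub>CC\<^esub> t) \<leftharpoonup>\<^bsub>CC\<^esub> \<one>\<^bsub>A\<^esub> = incl (s' \<oplus>\<^bsub>tensor A C1 C1\<^esub> t')"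
      "s' \<oplus>\<^bsub>tensor A C1 C1\<^esub> t' \<in> carrier (tensor A C1 C1)"
      by (simp_all only: add CC.add_ract A.one_closed bimodule_homD(2)[OF incl_hom] CC1.P.G.a_closed)
    then show ?case by blast
  qed
qed

text \<open>For \<open>c = c 1\<close> right linearity gives
  \<open>\<Delta> c = (\<Delta> c) 1\<close>, an element of the image of \<open>incl\<close>; hence
  \<open>inv_into\<close> returns a genuine preimage.\<close>

lemma restricted_comult:
  assumes "c \<in> carrier C1"
  shows "restricted_comult A C \<Delta> c \<in> carrier (tensor A C1 C1)"
    and "incl (restricted_comult A C \<Delta> c) = \<Delta> c"
proof -
  have "\<Delta> c = \<Delta> c \<leftharpoonup>\<^bsub>CC\<^esub> \<one>\<^bsub>A\<^esub>"
    using comult(4)[of "\<one>\<^bsub>A\<^esub>" c] assms by (simp add: mem_right_unital_part)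
  then have "\<Delta> c \<in> incl ` carrier (tensor A C1 C1)"
    using ract_one_in_image[of "\<Delta> c"] comult(1)[of c] assms C1_sub by metis
  then show "restricted_comult A C \<Delta> c \<in> carrier (tensor A C1 C1)"
    and "incl (restricted_comult A C \<Delta> c) = \<Delta> c"
    unfolding restricted_comult_def by (rule inv_into_into, rule f_inv_into_f)
qed

abbreviation res where "res f \<equiv> restrict f (carrier C1)"

lemma res_closed: "f \<in> carrier D \<Longrightarrow> res f \<in> carrier S"
  by (rule left_dualI)
    (use C1.M.a_closed C1.lact_closed in \<open>auto simp: left_dualD C1_sub\<close>)

lemma res_hom: "res \<in> bimodule_hom A DU S"
proof -
  note eqI = left_dual_eqI[where A = A and C = C1]
  have sub: "f \<in> carrier D" if "f \<in> carrier DU" for f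
    using that by (simp add: D.mem_left_unital_part)
  note apply' = left_dual_apply[where C = C1] left_dual_apply[where C = C, OF C1_sub]
  show ?thesis
    unfolding bimodule_hom_def
    by (intro CollectI conjI ballI Pi_I eqI; (intro res_closed S.M.a_closed S.lact_closed S.ract_closed
        DU.M.a_closed DU.lact_closed DU.ract_closed sub; assumption)?)
      (use C1.ract_closed in \<open>simp_all add: apply'\<close>)
qed

lemma res_bij: "bij_betw res (carrier DU) (carrier S)"
proof (rule bij_betw_byWitness[where f' = "\<lambda>h. \<lambda>c\<in>carrier C. h (c \<leftharpoonup>\<^bsub>C\<^esub> \<one>\<^bsub>A\<^esub>)"])
  \<comment> \<open>Evaluated at \<open>c\<close>, the equation \<open>1 f = f\<close> says that
    \<open>f\<close> factors through \<open>c \<mapsto> c 1\<close>, so its restriction to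
    \<open>C 1\<close> determines it.\<close>
  have DU: "f \<in> carrier D \<and> (\<forall>c\<in>carrier C. f (c \<leftharpoonup>\<^bsub>C\<^esub> \<one>\<^bsub>A\<^esub>) = f c)" if "f \<in> carrier DU" for f
    using that by (auto simp: D.mem_left_unital_part left_dual_simps fun_eq_iff split: if_splits)
  show "\<forall>f\<in>carrier DU. (\<lambda>c\<in>carrier C. res f (c \<leftharpoonup>\<^bsub>C\<^esub> \<one>\<^bsub>A\<^esub>)) = f"
  proof
    fix f assume "f \<in> carrier DU"
    with DU[of f] left_dualD(4)[of f A C] show "(\<lambda>c\<in>carrier C. res f (c \<leftharpoonup>\<^bsub>C\<^esub> \<one>\<^bsub>A\<^esub>)) = f"
      by (intro extensionalityI[of _ "carrier C"]) (auto simp: ract_one_C1)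
  qed
  show "\<forall>h\<in>carrier S. res (\<lambda>c\<in>carrier C. h (c \<leftharpoonup>\<^bsub>C\<^esub> \<one>\<^bsub>A\<^esub>)) = h"
  proof
    fix h assume "h \<in> carrier S"
    with left_dualD(4)[of h A C1] show "res (\<lambda>c\<in>carrier C. h (c \<leftharpoonup>\<^bsub>C\<^esub> \<one>\<^bsub>A\<^esub>)) = h"
      by (intro extensionalityI[of _ "carrier C1"]) (auto simp: mem_right_unital_part)
  qed
  show "res ` carrier DU \<subseteq> carrier S"
    using DU res_closed by auto
  show "(\<lambda>h. \<lambda>c\<in>carrier C. h (c \<leftharpoonup>\<^bsub>C\<^esub> \<one>\<^bsub>A\<^esub>)) ` carrier S \<subseteq> carrier DU"
  proof clarify
    fix h assume h: "h \<in> carrier S"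
    let ?f = "\<lambda>c\<in>carrier C. h (c \<leftharpoonup>\<^bsub>C\<^esub> \<one>\<^bsub>A\<^esub>)"
    have f: "?f \<in> carrier D"
      by (rule left_dualI)
        (use left_dualD[OF h] in \<open>auto simp: ract_one_C1 add_ract lact_ract lact_closed\<close>)
    \<comment> \<open>The extension by \<open>c \<mapsto> h (c 1)\<close> lands in the unital part
      because \<open>(c 1) 1 = c 1\<close>.\<close>
    moreover have "\<one>\<^bsub>A\<^esub> \<rightharpoonup>\<^bsub>D\<^esub> ?f = ?f"
      by (intro left_dual_eqI[where A = A and C = C] D.lact_closed f A.one_closed)
        (simp add: left_dual_apply ract_closed flip: ract_mult)
    ultimately show "?f \<in> carrier DU" by (simp add: D.mem_left_unital_part)
  qed
qed

text \<open>On pure tensors over \<open>C 1\<close>, contracting with \<open>res f\<close> is the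
  same as applying \<open>incl\<close> and contracting with \<open>f\<close>; and
  \<open>incl\<close> sends the restricted comultiplication back to
  \<open>\<Delta> c\<close>.\<close>

lemma dual_conv_res:
  assumes "f \<in> carrier DU" "g \<in> carrier DU"
  shows "dual_conv C1 (restricted_comult A C \<Delta>) (res f) (res g) = res (conv f g)"
proof (rule extensionalityI[of _ "carrier C1"])
  fix c assume c: "c \<in> carrier C1"
  have f: "f \<in> carrier D" and g: "g \<in> carrier D"
    using assms by (auto simp: D.mem_left_unital_part)
  note D1 = restricted_comult[OF c]
  interpret f: balanced_map A C C C "\<lambda>x y. x \<leftharpoonup>\<^bsub>C\<^esub> f y" by (rule con_balanced) fact
  interpret r: balanced_map A C1 C1 C1 "\<lambda>x y. x \<leftharpoonup>\<^bsub>C1\<^esub> res f y"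
    by (rule right_contraction_balanced_map[OF C1.bimodule_axioms res_closed[OF f]])
  have "right_contraction C1 (restricted_comult A C \<Delta>) (res f) c =
      tensor_lift C (\<lambda>x y. x \<leftharpoonup>\<^bsub>C\<^esub> f y) (incl (restricted_comult A C \<Delta> c))"
    unfolding right_contraction_def
    by (rule r.lift_eqI[OF D1(1), symmetric])
      (simp_all add: id_def bimodule_homD[OF incl_hom, unfolded id_def] incl_pure[unfolded id_def]
        f.lift_add f.lift_pure C1_sub)
  also have "\<dots> = con f c" by (simp add: D1 right_contraction_def)
  finally have eq: "right_contraction C1 (restricted_comult A C \<Delta>) (res f) c = con f c" .
  \<comment> \<open>The contraction stays in \<open>C 1\<close>, where \<open>res g\<close> and
    \<open>g\<close> agree.\<close>
  moreover have "right_contraction C1 (restricted_comult A C \<Delta>) (res f) c \<in> carrier C1"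
    unfolding right_contraction_def by (rule r.lift_closed[OF D1(1)])
  ultimately show "dual_conv C1 (restricted_comult A C \<Delta>) (res f) (res g) c = res (conv f g) c"
    using c by (simp add: dual_conv_apply C1_sub)
qed (auto simp: dual_conv_def)

lemma A_rings_isomorphic_dual:
  "A_rings_isomorphic A DU (restricted_mult A D (dual_mult A C \<Delta>)) (dual_unit A C \<epsilon>)
    S (dual_mult A C1 (restricted_comult A C \<Delta>)) (dual_unit A C1 \<epsilon>)"
proof -
  interpret L: right_unital_lax_ring A D "dual_mult A C \<Delta>" "dual_unit A C \<epsilon>"
    by (rule right_unital_lax_ring_dual)
  show ?thesis
    unfolding dual_mult_def[of A C1]
  proof (rule A_ring_transport[OF L.A_ring_left_unital_part S.bimodule_axioms res_hom res_bij])
    fix f g assume "f \<in> carrier DU" "g \<in> carrier DU"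
    then show "dual_conv C1 (restricted_comult A C \<Delta>) (res f) (res g) =
        res (restricted_mult A D (dual_mult A C \<Delta>) (pure_tensor A DU DU f g))"
      by (simp add: L.restricted_mult_pure mult_pure L.U_sub dual_conv_res)
  next
    fix a
    show "dual_unit A C1 \<epsilon> a = res (dual_unit A C \<epsilon> a)"
      by (auto simp: dual_unit_def C1_sub)
  qed
qed

end

theorem proposition1p2:
  fixes A :: "('a, 'x) ring_scheme"
    and C :: "('a, 'c) bimodule"
    and \<Delta> :: "'c \<Rightarrow> ('c, 'c) tensor"
    and \<epsilon> :: "'c \<Rightarrow> 'a"
  assumes "ring A"
  shows "(left_unital_weak_coring A C \<Delta> \<epsilon> \<longrightarrow>
            right_unital_weak_ring A (left_dual A C) (dual_mult A C \<Delta>) (dual_unit A C \<epsilon>)) \<and>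
         (left_unital_lax_coring A C \<Delta> \<epsilon> \<longrightarrow>
            right_unital_lax_ring A (left_dual A C) (dual_mult A C \<Delta>) (dual_unit A C \<epsilon>)) \<and>
         (left_unital_weak_coring A C \<Delta> \<epsilon> \<or> left_unital_lax_coring A C \<Delta> \<epsilon> \<longrightarrow>
            A_rings_isomorphic A
              (left_unital_part A (left_dual A C))
              (restricted_mult A (left_dual A C) (dual_mult A C \<Delta>))
              (dual_unit A C \<epsilon>)
              (left_dual A (right_unital_part A C))
              (dual_mult A (right_unital_part A C) (restricted_comult A C \<Delta>))
              (dual_unit A (right_unital_part A C) \<epsilon>))"
  using left_unital_weak_coring.right_unital_weak_ring_dual
    left_unital_lax_coring.right_unital_lax_ring_dual
    left_unital_lax_coring.A_rings_isomorphic_dual left_unital_weak_coring.lax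
  by blast

end
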